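(* Let $M$ be a smooth manifold and $\mu$ a nonnegative density on $M$. Then there exists a unique regular Radon measure $\tilde\mu$ on $M$ such that $$\int_M f\,\mu=\int_M f\,d\tilde\mu\qquad\text{for all } f\in C_c(M).$$
   Context: A density on an $n$-dimensional real vector space $V$ is a function $\mu:V^n\to\mathbb{R}$ with $\mu(Tv_1,\dots,Tv_n)=|\det T|\,\mu(v_1,\dots,v_n)$ for every linear $T:V\to V$; it is nonnegative if all its values are $\ge 0$. A density on $M$ ($\dim M=n$) is a continuous section of the smooth line bundle $\mathcal{D}M=\bigsqcup_q\mathcal{D}(T_qM)$; nonnegative means nonnegative at each point. The integral of a compactly supported density is defined as usual: in a chart, $\mu=f\,|dx_1\wedge\cdots\wedge dx_n|$ with support compact in the chart domain integrates as the Riemann integral $\int f\,dx$, extended by a partition of unity. $C_c(M)$ is the space of continuous compactly supported real functions on $M$. A Radon measure is a Borel measure that is finite on compact sets, outer regular on all Borel sets and inner regular on open sets; it is regular if it is both outer and inner regular on all Borel sets. Manifolds are Hausdorff and second countable. *)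

theory Defs
  imports "HOL-Analysis.Analysis" "HOL-Library.Function_Algebras"
begin

section \<open>Densities on a vector space\<close>

text \<open>
  Index types are nonempty, so \<open>real ^ 'n\<close> never has dimension 0. To cover every
  dimension \<open>n \<ge> 0\<close>, indices range over a subset \<open>I\<close> of a finite type, and \<open>n = card I\<close>.
  An \<open>n\<close>-tuple of vectors of \<open>V\<close> is an element of \<open>I \<rightarrow>\<^sub>E V\<close>.
\<close>

definition basis_of :: "'n set \<Rightarrow> 'v::real_vector set \<Rightarrow> ('n \<Rightarrow> 'v) \<Rightarrow> bool" where
  "basis_of I V b \<longleftrightarrow> inj_on b I \<and> independent (b ` I) \<and> span (b ` I) = V"

text \<open>
  \<open>has_det I V T d\<close> says that the endomorphism \<open>T\<close> of \<open>V\<close> has determinant \<open>d\<close>: its matrix \<open>C\<close>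
  in some (equivalently, every) basis indexed by \<open>I\<close> has determinant \<open>d\<close>. The \<open>I \<times> I\<close> matrix is
  completed by an identity block, which does not change the determinant; the empty
  matrix has determinant 1.
\<close>

definition has_det ::
    "'n::finite set \<Rightarrow> 'v::real_vector set \<Rightarrow> ('v \<Rightarrow> 'v) \<Rightarrow> real \<Rightarrow> bool" where
  "has_det I V T d \<longleftrightarrow>
     (\<exists>b C. basis_of I V b \<and>
        (\<forall>j\<in>I. T (b j) = (\<Sum>i\<in>I. C i j *\<^sub>R b i)) \<and>
        d = det (\<chi> i j. if i \<in> I \<and> j \<in> I then C i j else if i = j then 1 else 0))"

text \<open>
  Since linear maps extend from subspaces, the linear maps \<open>V \<rightarrow> V\<close> are the restrictions of
  the linear maps \<open>T\<close> of the ambient type with \<open>T ` V \<subseteq> V\<close>. Functions on \<open>I \<rightarrow>\<^sub>E V\<close> are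
  represented by total functions that vanish elsewhere.
\<close>

definition densities ::
    "'n::finite set \<Rightarrow> 'v::real_vector set \<Rightarrow> (('n \<Rightarrow> 'v) \<Rightarrow> real) set" where
  "densities I V =
     {\<delta>. (\<forall>v. v \<notin> (I \<rightarrow>\<^sub>E V) \<longrightarrow> \<delta> v = 0) \<and>
         (\<forall>T d v. linear T \<and> T ` V \<subseteq> V \<and> has_det I V T d \<and> v \<in> (I \<rightarrow>\<^sub>E V) \<longrightarrow>
            \<delta> (\<lambda>i\<in>I. T (v i)) = \<bar>d\<bar> * \<delta> v)}"


section \<open>Smooth manifolds\<close>

text \<open>The copy of \<open>R^n\<close> on which manifolds are modelled, again with \<open>n = card I\<close>.\<close>

definition model_space :: "'n::finite set \<Rightarrow> (real ^ 'n) set" where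
  "model_space I = {x. \<forall>i. i \<notin> I \<longrightarrow> x $ i = 0}"

text \<open>
  The following are meant for relatively open \<open>S \<subseteq> model_space I\<close>. A derivative within such a
  set is uniquely determined on \<open>model_space I\<close>, and is only ever applied to vectors from there.
\<close>

primrec Ck_on ::
    "nat \<Rightarrow> 'n::finite set \<Rightarrow> (real ^ 'n) set \<Rightarrow> (real ^ 'n \<Rightarrow> 'b::real_normed_vector) \<Rightarrow> bool" where
  "Ck_on 0 I S f \<longleftrightarrow> continuous_on S f"
| "Ck_on (Suc k) I S f \<longleftrightarrow>
     f differentiable_on S \<and>
     (\<forall>i\<in>I. Ck_on k I S (\<lambda>x. frechet_derivative f (at x within S) (axis i 1)))"

definition smooth_on ::
    "'n::finite set \<Rightarrow> (real ^ 'n) set \<Rightarrow> (real ^ 'n \<Rightarrow> 'b::real_normed_vector) \<Rightarrow> bool" where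
  "smooth_on I S f \<longleftrightarrow> (\<forall>k. Ck_on k I S f)"

text \<open>A chart consists of its domain and its coordinate map.\<close>

type_synonym ('m, 'n) chart = "'m set \<times> ('m \<Rightarrow> real ^ 'n)"

definition is_chart :: "'m topology \<Rightarrow> 'n::finite set \<Rightarrow> ('m, 'n) chart \<Rightarrow> bool" where
  "is_chart M I c \<longleftrightarrow>
     openin M (fst c) \<and>
     openin (top_of_set (model_space I)) (snd c ` fst c) \<and>
     homeomorphic_map (subtopology M (fst c)) (top_of_set (snd c ` fst c)) (snd c)"

definition transition :: "('m, 'n::finite) chart \<Rightarrow> ('m, 'n) chart \<Rightarrow> real ^ 'n \<Rightarrow> real ^ 'n" where
  "transition c d = snd d \<circ> inv_into (fst c) (snd c)"

definition compatible :: "'n::finite set \<Rightarrow> ('m, 'n) chart \<Rightarrow> ('m, 'n) chart \<Rightarrow> bool" where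
  "compatible I c d \<longleftrightarrow>
     smooth_on I (snd c ` (fst c \<inter> fst d)) (transition c d) \<and>
     smooth_on I (snd d ` (fst c \<inter> fst d)) (transition d c)"

text \<open>The smooth structure is a maximal smooth atlas \<open>A\<close>.\<close>

definition smooth_manifold :: "'m topology \<Rightarrow> 'n::finite set \<Rightarrow> ('m, 'n) chart set \<Rightarrow> bool" where
  "smooth_manifold M I A \<longleftrightarrow>
     Hausdorff_space M \<and> second_countable M \<and>
     (\<forall>c\<in>A. is_chart M I c) \<and>
     (\<Union>c\<in>A. fst c) = topspace M \<and>
     (\<forall>c\<in>A. \<forall>d\<in>A. compatible I c d) \<and>
     (\<forall>c. is_chart M I c \<and> (\<forall>d\<in>A. compatible I c d) \<longrightarrow> c \<in> A)"


section \<open>Tangent spaces\<close>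

instantiation "fun" :: (type, real_vector) real_vector
begin

definition scaleR_fun :: "real \<Rightarrow> ('a \<Rightarrow> 'b) \<Rightarrow> 'a \<Rightarrow> 'b" where
  "scaleR_fun r f = (\<lambda>x. r *\<^sub>R f x)"

instance
  by standard (simp_all add: scaleR_fun_def fun_eq_iff scaleR_add_left scaleR_add_right)

end

text \<open>
  The differential at \<open>q\<close> of the change of coordinates from \<open>c\<close> to \<open>d\<close>.
\<close>

definition jacobian ::
    "('m, 'n::finite) chart \<Rightarrow> ('m, 'n) chart \<Rightarrow> 'm \<Rightarrow> real ^ 'n \<Rightarrow> real ^ 'n" where
  "jacobian c d q =
     frechet_derivative (transition c d) (at (snd c q) within snd c ` (fst c \<inter> fst d))"

text \<open>
  A tangent vector at \<open>q\<close> is the family of its coordinate vectors in all charts around \<open>q\<close>,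
  related by the chain rule; the vector space operations are pointwise.
\<close>

type_synonym ('m, 'n) tangent = "('m, 'n) chart \<Rightarrow> real ^ 'n"

definition tangent_space ::
    "'n::finite set \<Rightarrow> ('m, 'n) chart set \<Rightarrow> 'm \<Rightarrow> ('m, 'n) tangent set" where
  "tangent_space I A q =
     {v. (\<forall>c. \<not> (c \<in> A \<and> q \<in> fst c) \<longrightarrow> v c = 0) \<and>
         (\<forall>c\<in>A. q \<in> fst c \<longrightarrow> v c \<in> model_space I) \<and>
         (\<forall>c\<in>A. \<forall>d\<in>A. q \<in> fst c \<inter> fst d \<longrightarrow> v d = jacobian c d q (v c))}"

text \<open>
  The frame \<open>(\<partial>/\<partial>x\<^sub>i)\<^sub>i\<close> of the tangent space at \<open>q\<close> given by the chart \<open>c\<close>: the \<open>i\<close>-th vector is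
  the one with coordinates \<open>axis i 1\<close> in \<open>c\<close> itself.
\<close>

definition coord_frame ::
    "'n::finite set \<Rightarrow> ('m, 'n) chart set \<Rightarrow> ('m, 'n) chart \<Rightarrow> 'm \<Rightarrow> 'n \<Rightarrow> ('m, 'n) tangent" where
  "coord_frame I A c q =
     (\<lambda>i\<in>I. \<lambda>d. if d \<in> A \<and> q \<in> fst d then jacobian c d q (axis i 1) else 0)"


section \<open>Densities on a manifold\<close>

text \<open>
  The total space of the density bundle, a point of which is a pair \<open>(q, \<delta>)\<close> with \<open>\<delta>\<close> a density
  on the tangent space at \<open>q\<close>. The local trivialisation over the domain of a chart \<open>c\<close> is
  \<open>(q, \<delta>) \<mapsto> (q, \<delta> (\<partial>/\<partial>x\<^sub>1, \<dots>, \<partial>/\<partial>x\<^sub>n))\<close>, and the topology is the one that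
  makes all of these homeomorphisms onto \<open>U \<times> R\<close>.
\<close>

definition density_total ::
    "'m topology \<Rightarrow> 'n::finite set \<Rightarrow> ('m, 'n) chart set \<Rightarrow>
      ('m \<times> (('n \<Rightarrow> ('m, 'n) tangent) \<Rightarrow> real)) set" where
  "density_total M I A = (SIGMA q : topspace M. densities I (tangent_space I A q))"

definition density_bundle ::
    "'m topology \<Rightarrow> 'n::finite set \<Rightarrow> ('m, 'n) chart set \<Rightarrow>
      ('m \<times> (('n \<Rightarrow> ('m, 'n) tangent) \<Rightarrow> real)) topology" where
  "density_bundle M I A = topology_generated_by
     {{(q, \<delta>) \<in> density_total M I A. q \<in> W \<and> \<delta> (coord_frame I A c q) \<in> J} | c W J.
        c \<in> A \<and> openin M W \<and> W \<subseteq> fst c \<and> open J}"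

definition is_density ::
    "'m topology \<Rightarrow> 'n::finite set \<Rightarrow> ('m, 'n) chart set \<Rightarrow>
      ('m \<Rightarrow> ('n \<Rightarrow> ('m, 'n) tangent) \<Rightarrow> real) \<Rightarrow> bool" where
  "is_density M I A \<mu> \<longleftrightarrow> continuous_map M (density_bundle M I A) (\<lambda>q. (q, \<mu> q))"

definition nonneg_density ::
    "'m topology \<Rightarrow> 'n::finite set \<Rightarrow> ('m, 'n) chart set \<Rightarrow>
      ('m \<Rightarrow> ('n \<Rightarrow> ('m, 'n) tangent) \<Rightarrow> real) \<Rightarrow> bool" where
  "nonneg_density M I A \<mu> \<longleftrightarrow>
     is_density M I A \<mu> \<and>
     (\<forall>q\<in>topspace M. \<forall>v \<in> I \<rightarrow>\<^sub>E tangent_space I A q. 0 \<le> \<mu> q v)"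

definition density_scale ::
    "('m \<Rightarrow> real) \<Rightarrow> ('m \<Rightarrow> ('n \<Rightarrow> ('m, 'n) tangent) \<Rightarrow> real) \<Rightarrow>
      'm \<Rightarrow> ('n \<Rightarrow> ('m, 'n) tangent) \<Rightarrow> real" where
  "density_scale f \<mu> = (\<lambda>q v. f q * \<mu> q v)"


section \<open>Integration of densities\<close>

definition supp :: "'m topology \<Rightarrow> ('m \<Rightarrow> real) \<Rightarrow> 'm set" where
  "supp M f = M closure_of {q \<in> topspace M. f q \<noteq> 0}"

definition density_supp ::
    "'m topology \<Rightarrow> ('m \<Rightarrow> ('n \<Rightarrow> ('m, 'n) tangent) \<Rightarrow> real) \<Rightarrow> 'm set" where
  "density_supp M \<nu> = M closure_of {q \<in> topspace M. \<exists>v. \<nu> q v \<noteq> 0}"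

text \<open>
  The integral of \<open>\<nu> = h |dx\<^sub>1 \<and> \<dots> \<and> dx\<^sub>n|\<close>, with compact support in the domain of \<open>c\<close>. The
  coefficient is \<open>h = \<nu> (\<partial>/\<partial>x\<^sub>1, \<dots>, \<partial>/\<partial>x\<^sub>n)\<close>, extended by 0 outside the image of the chart. The
  integration over \<open>R^n\<close> is with respect to the product of one-dimensional Lebesgue measures
  (a unit point mass if \<open>I = {}\<close>); it agrees with the Riemann integral for continuous
  compactly supported \<open>h\<close>.
\<close>

definition chart_integral ::
    "'n::finite set \<Rightarrow> ('m, 'n) chart set \<Rightarrow> ('m, 'n) chart \<Rightarrow>
      ('m \<Rightarrow> ('n \<Rightarrow> ('m, 'n) tangent) \<Rightarrow> real) \<Rightarrow> real" where
  "chart_integral I A c \<nu> =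
     (LINT x | (\<Pi>\<^sub>M i\<in>I. lborel).
        (let y = (\<chi> i. if i \<in> I then x i else 0);
            q = inv_into (fst c) (snd c) y
        in if y \<in> snd c ` fst c then \<nu> q (coord_frame I A c q) else 0))"

text \<open>
  \<open>s\<close> is computed from finitely many charts \<open>c j\<close> and a continuous partition of unity \<open>\<psi> j\<close>
  on the support of \<open>\<nu>\<close> subordinate to their domains.
\<close>

definition has_density_integral ::
    "'m topology \<Rightarrow> 'n::finite set \<Rightarrow> ('m, 'n) chart set \<Rightarrow>
      ('m \<Rightarrow> ('n \<Rightarrow> ('m, 'n) tangent) \<Rightarrow> real) \<Rightarrow> real \<Rightarrow> bool" where
  "has_density_integral M I A \<nu> s \<longleftrightarrow>
     (\<exists>(k::nat) c \<psi>.
        (\<forall>j<k. c j \<in> A \<and> continuous_map M euclideanreal (\<psi> j) \<and>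
           (\<forall>q\<in>topspace M. 0 \<le> \<psi> j q \<and> \<psi> j q \<le> 1) \<and> supp M (\<psi> j) \<subseteq> fst (c j)) \<and>
        (\<forall>q\<in>density_supp M \<nu>. (\<Sum>j<k. \<psi> j q) = 1) \<and>
        s = (\<Sum>j<k. chart_integral I A (c j) (density_scale (\<psi> j) \<nu>)))"

text \<open>Meant for compactly supported \<open>\<nu>\<close>, for which the value does not depend on the choices.\<close>

definition density_integral ::
    "'m topology \<Rightarrow> 'n::finite set \<Rightarrow> ('m, 'n) chart set \<Rightarrow>
      ('m \<Rightarrow> ('n \<Rightarrow> ('m, 'n) tangent) \<Rightarrow> real) \<Rightarrow> real" where
  "density_integral M I A \<nu> = (THE s. has_density_integral M I A \<nu> s)"


section \<open>Radon measures\<close>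

definition Cc :: "'m topology \<Rightarrow> ('m \<Rightarrow> real) set" where
  "Cc M = {f. continuous_map M euclideanreal f \<and> compactin M (supp M f)}"

definition borel_measure :: "'m topology \<Rightarrow> 'm measure \<Rightarrow> bool" where
  "borel_measure M N \<longleftrightarrow>
     space N = topspace M \<and> sets N = sigma_sets (topspace M) {U. openin M U}"

definition outer_regular_at :: "'m topology \<Rightarrow> 'm measure \<Rightarrow> 'm set \<Rightarrow> bool" where
  "outer_regular_at M N E \<longleftrightarrow> emeasure N E = (INF U \<in> {U. openin M U \<and> E \<subseteq> U}. emeasure N U)"

definition inner_regular_at :: "'m topology \<Rightarrow> 'm measure \<Rightarrow> 'm set \<Rightarrow> bool" where
  "inner_regular_at M N E \<longleftrightarrow> emeasure N E = (SUP K \<in> {K. compactin M K \<and> K \<subseteq> E}. emeasure N K)"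

definition radon_measure :: "'m topology \<Rightarrow> 'm measure \<Rightarrow> bool" where
  "radon_measure M N \<longleftrightarrow>
     borel_measure M N \<and>
     (\<forall>K. compactin M K \<longrightarrow> emeasure N K < \<infinity>) \<and>
     (\<forall>E\<in>sets N. outer_regular_at M N E) \<and>
     (\<forall>U. openin M U \<longrightarrow> inner_regular_at M N U)"

definition regular_radon_measure :: "'m topology \<Rightarrow> 'm measure \<Rightarrow> bool" where
  "regular_radon_measure M N \<longleftrightarrow>
     radon_measure M N \<and> (\<forall>E\<in>sets N. outer_regular_at M N E \<and> inner_regular_at M N E)"

end

theory Submission
  imports Defs
begin

text \<open>
  No Riesz representation theorem is needed. In a chart, the density has a nonnegative continuous
  coefficient \<open>h\<close>, and \<open>h dx\<close> pulls back to a Borel measure on the domain of the chart. By the change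
  of variables formula, the transformation law of densities says exactly that the measures of
  two charts agree on the overlap, so they glue along a countable cover to a single Borel measure,
  which is finite on compact sets. Regularity is automatic, since every open subset of a
  locally compact second countable Hausdorff space is \<open>\<sigma>\<close>-compact; uniqueness follows from Urysohn
  functions. The density integral is computed by any partition of unity, and each of its terms
  is an integral against the glued measure.
\<close>

subsection \<open>Change of variables for arbitrary finite index types\<close>

text \<open>The dimension is \<open>card I\<close>, possibly smaller than the number of coordinates
  of \<open>real ^ 'n\<close>, or 0. If \<open>I\<close> is a proper subset, the model space is a
  Lebesgue null set, and derivatives within it are determined only along its own directions. Maps
  between charts are therefore multiplied by the identity in the complementary coordinates before
  the change of variables formula is applied; the Jacobian is then block diagonal, with just the
  determinant used by \<open>has_det\<close>. Charts are compared on Borel sets, with nonnegative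
  integrals that may be infinite. Signed functions enter only through equalities of measures, so no
  splitting into positive and negative parts occurs. A partition of unity for \<open>f \<mu>\<close>
  has to sum to 1 only on the support of \<open>f \<mu>\<close>, which can be smaller than that of
  \<open>f\<close>. The density vanishes wherever this makes a difference, so the glued measure
  gives such points no mass.\<close>

text \<open>
  The change of variables theorem of HOL-Analysis requires a wellordered index type; \<open>'n wo\<close> is
  a copy of \<open>'n\<close> carrying an arbitrarily chosen order.
\<close>

datatype 'n wo = Wo (unWo: 'n)

lemma bij_Wo: "bij Wo"
  by (rule o_bij[of unWo]) (auto simp: fun_eq_iff)

lemma bij_unWo: "bij unWo"
  by (rule o_bij[of Wo]) (auto simp: fun_eq_iff)

instance wo :: (finite) finite
proof
  have "range Wo = (UNIV :: 'a wo set)"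
    by (rule bij_is_surj[OF bij_Wo])
  then show "finite (UNIV :: 'a wo set)"
    by (metis finite_code finite_imageI)
qed

definition wo_index :: "'n::finite wo \<Rightarrow> nat" where
  "wo_index = (SOME f. inj f)"

lemma inj_wo_index: "inj (wo_index :: 'n::finite wo \<Rightarrow> nat)"
  unfolding wo_index_def
proof (rule someI_ex[of inj])
  obtain f and m :: nat where "f ` (UNIV :: 'n wo set) = {i. i < m}" "inj f"
    using finite_imp_inj_to_nat_seg[OF finite_class.finite_UNIV] by blast
  then show "\<exists>f :: 'n wo \<Rightarrow> nat. inj f" by blast
qed

instantiation wo :: (finite) wellorder
begin

definition less_eq_wo :: "'a wo \<Rightarrow> 'a wo \<Rightarrow> bool" where
  "less_eq_wo a b \<longleftrightarrow> wo_index a \<le> wo_index b"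

definition less_wo :: "'a wo \<Rightarrow> 'a wo \<Rightarrow> bool" where
  "less_wo a b \<longleftrightarrow> wo_index a < wo_index b"

instance
proof
  fix P :: "'a wo \<Rightarrow> bool" and a
  assume step: "\<And>x. (\<And>y. y < x \<Longrightarrow> P y) \<Longrightarrow> P x"
  show "P a"
    by (induction "wo_index a" arbitrary: a rule: less_induct) (auto intro: step simp: less_wo_def)
qed (use inj_wo_index in \<open>auto simp: less_eq_wo_def less_wo_def inj_def\<close>)

end

text \<open>\<open>det\<close> sums over permutations of the index type, and conjugation by
  \<open>Wo\<close> is a sign-preserving bijection between the two permutation groups that matches
  the summands.\<close>

lemma det_reindex_wo:
  fixes A :: "real ^ 'n::finite ^ 'n"
  shows "det (\<chi> i j. A $ unWo i $ unWo j) = det A"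
proof -
  let ?m = "map_permutation (UNIV :: 'n set) Wo"
  have m: "?m p = Wo \<circ> p \<circ> unWo" for p
  proof -
    have "inv Wo = (unWo :: 'n wo \<Rightarrow> 'n)"
      by (rule inv_unique_comp) (auto simp: fun_eq_iff)
    moreover have "range Wo = (UNIV :: 'n wo set)"
      by (rule bij_is_surj[OF bij_Wo])
    ultimately show ?thesis
      by (simp add: map_permutation_def restrict_id_def fun_eq_iff)
  qed
  have bij: "bij_betw ?m {p. p permutes UNIV} {p. p permutes UNIV}"
  proof (rule bij_betwI[where g = "\<lambda>p. unWo \<circ> p \<circ> Wo"])
    show "?m \<in> {p. p permutes UNIV} \<rightarrow> {p. p permutes UNIV}"
      using map_permutation_permutes[OF bij_Wo] by auto
    show "(\<lambda>p. unWo \<circ> p \<circ> Wo) \<in> {p. p permutes (UNIV :: 'n wo set)} \<rightarrow> {p. p permutes UNIV}"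
      using bij_comp[OF bij_Wo bij_comp[OF _ bij_unWo]]
      by (auto intro!: bij_imp_permutes dest!: permutes_imp_bij simp: o_assoc)
  qed (auto simp: m fun_eq_iff)
  have "det (\<chi> i j. A $ unWo i $ unWo j) =
      (\<Sum>p | p permutes (UNIV :: 'n set).
         of_int (sign (?m p)) * (\<Prod>i\<in>UNIV. A $ unWo i $ unWo (?m p i)))"
    unfolding det_def by (subst sum.reindex_bij_betw[OF bij, symmetric]) simp
  also have "\<dots> = (\<Sum>p | p permutes (UNIV :: 'n set). of_int (sign p) * (\<Prod>i\<in>UNIV. A $ i $ p i))"
  proof (rule sum.cong, rule refl)
    fix p :: "'n \<Rightarrow> 'n" assume "p \<in> {p. p permutes UNIV}"
    then have "sign (?m p) = sign p"
      using bij_Wo by (intro sign_map_permutation) (auto simp: bij_def)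
    moreover have "(\<Prod>i\<in>UNIV. A $ unWo i $ unWo (?m p i)) = (\<Prod>i\<in>UNIV. A $ i $ p i)"
      unfolding m by (subst prod.reindex_bij_betw[OF bij_unWo, symmetric]) simp
    ultimately show "of_int (sign (?m p)) * (\<Prod>i\<in>UNIV. A $ unWo i $ unWo (?m p i)) =
        of_int (sign p) * (\<Prod>i\<in>UNIV. A $ i $ p i)"
      by simp
  qed
  finally show ?thesis
    by (simp add: det_def)
qed

text \<open>\<open>has_measure_differentiable_image\<close> deals with finite real integrals, while
  \<open>S\<close> and the determinant may be unbounded. So \<open>S\<close> is exhausted by pieces
  of finite measure on which the determinant is bounded, and monotone convergence passes to the
  limit.\<close>

lemma emeasure_lebesgue_image:
  fixes \<phi> :: "real ^ 'n::{finite,wellorder} \<Rightarrow> real ^ 'n::_"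
  assumes S: "S \<in> sets borel"
    and der: "\<And>x. x \<in> S \<Longrightarrow> (\<phi> has_derivative \<phi>' x) (at x within S)"
    and inj: "inj_on \<phi> S"
    and cont: "continuous_on S (\<lambda>x. det (matrix (\<phi>' x)))"
  shows "emeasure lebesgue (\<phi> ` S) =
    (\<integral>\<^sup>+ x. indicator S x * ennreal \<bar>det (matrix (\<phi>' x))\<bar> \<partial>lborel)"
proof -
  define D where "D x = indicator S x * \<bar>det (matrix (\<phi>' x))\<bar>" for x
  have "(\<lambda>x. indicator S x *\<^sub>R \<bar>det (matrix (\<phi>' x))\<bar>) \<in> borel_measurable borel"
    by (intro borel_measurable_continuous_on_indicator[OF S] continuous_on_rabs cont)
  then have D[measurable]: "D \<in> borel_measurable borel"
    by (simp add: D_def[abs_def])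
  define E where "E n = S \<inter> cball 0 (real n) \<inter> {x. D x \<le> real n}" for n :: nat
  have E[measurable]: "E n \<in> sets borel" for n
  proof -
    have "cball 0 (real n) \<in> sets borel" "{x. D x \<le> real n} \<in> sets borel"
      by measurable
    then show ?thesis
      unfolding E_def using S by blast
  qed
  have E_mono: "incseq E"
    unfolding incseq_def E_def by (auto intro: order_trans)
  have E_Un: "(\<Union>n. E n) = S"
  proof -
    have "\<exists>n. x \<in> E n" if "x \<in> S" for x
    proof -
      obtain n where "max (norm x) (D x) \<le> real n"
        using real_arch_simple by blast
      then show ?thesis
        using that by (auto simp: E_def)
    qed
    then show ?thesis
      by (auto simp: E_def)
  qed
  have piece: "\<phi> ` E n \<in> sets lebesgue \<and>
      emeasure lebesgue (\<phi> ` E n) = (\<integral>\<^sup>+ x. indicator (E n) x * ennreal (D x) \<partial>lborel)" for n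
  proof -
    have fin: "emeasure lborel (E n) < \<infinity>"
      by (rule emeasure_bounded_finite) (auto simp: E_def intro: bounded_subset[OF bounded_cball])
    have int: "integrable lborel (\<lambda>x. indicator (E n) x * D x)"
    proof (rule integrableI_bounded_set[where A = "E n" and B = "real n"])
      show "AE x in lborel. x \<in> E n \<longrightarrow> norm (indicator (E n) x * D x) \<le> real n"
      proof (intro AE_I2 impI)
        fix x assume "x \<in> E n"
        moreover from this have "D x \<le> real n" "0 \<le> D x"
          by (auto simp: E_def D_def)
        ultimately show "norm (indicator (E n) x * D x) \<le> real n"
          by simp
      qed
    qed (use fin in auto)
    have eq: "indicator (E n) x * D x = (if x \<in> E n then \<bar>det (matrix (\<phi>' x))\<bar> else 0)" for x
      by (auto simp: E_def D_def)
    have hi: "((\<lambda>x. \<bar>det (matrix (\<phi>' x))\<bar>) has_integral (\<integral>x. indicator (E n) x * D x \<partial>lborel)) (E n)"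
      using has_integral_integral_lborel[OF int] unfolding eq has_integral_restrict_UNIV .
    have "\<phi> ` E n \<in> lmeasurable \<and>
        measure lebesgue (\<phi> ` E n) = (\<integral>x. indicator (E n) x * D x \<partial>lborel)"
    proof (subst has_measure_differentiable_image[where f' = \<phi>'])
      show "E n \<in> sets lebesgue"
        by simp
      show "inj_on \<phi> (E n)"
        using inj by (rule inj_on_subset) (auto simp: E_def)
      show "(\<phi> has_derivative \<phi>' x) (at x within E n)" if "x \<in> E n" for x
        by (rule has_derivative_subset[OF der]) (use that in \<open>auto simp: E_def\<close>)
    qed (rule hi)
    moreover have "ennreal (\<integral>x. indicator (E n) x * D x \<partial>lborel) =
        (\<integral>\<^sup>+ x. ennreal (indicator (E n) x * D x) \<partial>lborel)"
      by (rule nn_integral_eq_integral[symmetric, OF int]) (auto simp: D_def)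
    moreover have "(\<integral>\<^sup>+ x. ennreal (indicator (E n) x * D x) \<partial>lborel) =
        (\<integral>\<^sup>+ x. indicator (E n) x * ennreal (D x) \<partial>lborel)"
      by (intro nn_integral_cong) (auto split: split_indicator)
    ultimately show ?thesis
      by (simp add: fmeasurableD emeasure_eq_measure2)
  qed
  have "emeasure lebesgue (\<phi> ` S) = (SUP n. emeasure lebesgue (\<phi> ` E n))"
  proof (subst SUP_emeasure_incseq)
    show "range (\<lambda>n. \<phi> ` E n) \<subseteq> sets lebesgue"
      using piece by auto
    show "incseq (\<lambda>n. \<phi> ` E n)"
      using E_mono by (auto simp: incseq_def)
  qed (simp flip: E_Un add: image_UN)
  also have "\<dots> = (SUP n. \<integral>\<^sup>+ x. indicator (E n) x * ennreal (D x) \<partial>lborel)"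
    using piece by simp
  also have "\<dots> = (\<integral>\<^sup>+ x. (SUP n. indicator (E n) x * ennreal (D x)) \<partial>lborel)"
  proof (rule nn_integral_monotone_convergence_SUP[symmetric])
    show "incseq (\<lambda>n x. indicator (E n) x * ennreal (D x))"
      using E_mono by (auto simp: incseq_def le_fun_def split: split_indicator)
  qed measurable
  also have "\<dots> = (\<integral>\<^sup>+ x. indicator S x * ennreal \<bar>det (matrix (\<phi>' x))\<bar> \<partial>lborel)"
  proof (rule nn_integral_cong)
    fix x
    have "(SUP n. indicator (E n) x * ennreal (D x)) = (SUP n. indicator (E n) x) * ennreal (D x)"
      by (rule SUP_mult_right_ennreal[symmetric])
    also have "(SUP n. indicator (E n) x :: ennreal) = indicator S x"
    proof (cases "x \<in> S")
      case True
      then obtain n where "x \<in> E n"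
        using E_Un by auto
      then show ?thesis
        using True by (intro antisym SUP_least) (auto intro!: SUP_upper2[of n] simp: indicator_def)
    next
      case False
      then show ?thesis
        using E_Un by auto
    qed
    finally show "(SUP n. indicator (E n) x * ennreal (D x)) =
        indicator S x * ennreal \<bar>det (matrix (\<phi>' x))\<bar>"
      by (auto simp: D_def split: split_indicator)
  qed
  finally show ?thesis .
qed

section \<open>Lebesgue measure under relabelling of coordinates\<close>

lemma prod_Basis_cart:
  "(\<Prod>b\<in>(Basis :: (real ^ 'n::finite) set). f b) = (\<Prod>i\<in>UNIV. f (axis i 1))"
  by (rule prod.reindex_bij_betw[symmetric])
    (auto simp: bij_betw_def Basis_vec_def inj_on_def axis_eq_axis)

lemma measurable_vec_lambda:
  "vec_lambda \<in> (\<Pi>\<^sub>M i\<in>(UNIV :: 'n::finite set). lborel) \<rightarrow>\<^sub>M (borel :: (real ^ 'n) measure)"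
  by (subst borel_measurable_euclidean_space) (auto simp: Basis_vec_def inner_axis)

text \<open>Boxes determine \<open>lborel\<close>, and the preimage of a box under
  \<open>vec_lambda\<close> is a product of intervals.\<close>

lemma distr_lborel_vec:
  "distr (\<Pi>\<^sub>M i\<in>(UNIV :: 'n::finite set). lborel) borel vec_lambda = (lborel :: (real ^ 'n) measure)"
proof (rule lborel_eqI[symmetric])
  interpret product_sigma_finite "\<lambda>_ :: 'n. lborel :: real measure" ..
  fix l u :: "real ^ 'n" assume le: "\<And>b. b \<in> Basis \<Longrightarrow> l \<bullet> b \<le> u \<bullet> b"
  have le': "l $ i \<le> u $ i" for i
    using le[of "axis i 1"] by (simp add: inner_axis axis_in_Basis_iff)
  have "vec_lambda -` box l u \<inter> space (\<Pi>\<^sub>M i\<in>UNIV. lborel) = (\<Pi>\<^sub>E i\<in>UNIV. {l $ i <..< u $ i})"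
    by (auto simp: mem_box_cart space_PiM PiE_iff)
  then have "emeasure (distr (\<Pi>\<^sub>M i\<in>UNIV. lborel) borel vec_lambda) (box l u) =
      (\<Prod>i\<in>UNIV. emeasure lborel {l $ i <..< u $ i})"
    by (simp add: emeasure_distr emeasure_PiM measurable_vec_lambda)
  also have "\<dots> = ennreal (\<Prod>i\<in>UNIV. u $ i - l $ i)"
    using le' by (simp add: prod_ennreal)
  finally show "emeasure (distr (\<Pi>\<^sub>M i\<in>UNIV. lborel) borel vec_lambda) (box l u) =
      ennreal (\<Prod>b\<in>Basis. (u - l) \<bullet> b)"
    by (simp add: prod_Basis_cart inner_axis)
qed simp

definition to_wo :: "real ^ 'n::finite \<Rightarrow> real ^ 'n wo" where
  "to_wo x = (\<chi> i. x $ unWo i)"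

definition of_wo :: "real ^ 'n wo \<Rightarrow> real ^ 'n::finite" where
  "of_wo x = (\<chi> i. x $ Wo i)"

lemma to_wo_of_wo [simp]: "to_wo (of_wo x) = x" "of_wo (to_wo y) = y"
  by (simp_all add: to_wo_def of_wo_def vec_eq_iff)

lemma linear_to_wo: "linear to_wo"
  by (rule linearI) (auto simp: to_wo_def vec_eq_iff)

lemma linear_of_wo: "linear of_wo"
  by (rule linearI) (auto simp: of_wo_def vec_eq_iff)

lemma measurable_to_wo [measurable]: "to_wo \<in> borel \<rightarrow>\<^sub>M borel"
  by (intro borel_measurable_continuous_onI linear_continuous_on linear_to_wo[unfolded linear_conv_bounded_linear])

lemma measurable_of_wo [measurable]: "of_wo \<in> borel \<rightarrow>\<^sub>M borel"
  by (intro borel_measurable_continuous_onI linear_continuous_on linear_of_wo[unfolded linear_conv_bounded_linear])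

text \<open>Relabelling coordinates only permutes the factors in the volume of a box.\<close>

lemma distr_lborel_to_wo: "distr lborel borel (to_wo :: real ^ 'n::finite \<Rightarrow> _) = lborel"
proof (rule lborel_eqI[symmetric])
  fix l u :: "real ^ 'n wo" assume le: "\<And>b. b \<in> Basis \<Longrightarrow> l \<bullet> b \<le> u \<bullet> b"
  have le': "l $ i \<le> u $ i" for i
    using le[of "axis i 1"] by (simp add: inner_axis axis_in_Basis_iff)
  have "to_wo -` box l u = box (of_wo l) (of_wo u)"
  proof (rule set_eqI)
    fix x
    have "(\<forall>i. P (unWo i) i) \<longleftrightarrow> (\<forall>i. P i (Wo i))" for P :: "'n \<Rightarrow> 'n wo \<Rightarrow> bool"
      by (metis wo.collapse wo.sel)
    then show "x \<in> to_wo -` box l u \<longleftrightarrow> x \<in> box (of_wo l) (of_wo u)"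
      by (simp add: mem_box_cart to_wo_def of_wo_def)
  qed
  then have "emeasure (distr lborel borel to_wo) (box l u) = emeasure lborel (box (of_wo l) (of_wo u))"
    by (simp add: emeasure_distr)
  also have "\<dots> = ennreal (\<Prod>b\<in>Basis. (of_wo u - of_wo l) \<bullet> b)"
    by (rule emeasure_lborel_box)
      (use le' in \<open>auto simp: Basis_vec_def inner_axis of_wo_def\<close>)
  also have "(\<Prod>b\<in>Basis. (of_wo u - of_wo l) \<bullet> b) = (\<Prod>i\<in>UNIV. u $ Wo i - l $ Wo i)"
    by (simp add: prod_Basis_cart inner_axis of_wo_def)
  also have "\<dots> = (\<Prod>i\<in>UNIV. u $ i - l $ i)"
    by (rule prod.reindex_bij_betw[OF bij_Wo])
  finally show "emeasure (distr lborel borel to_wo) (box l u) = ennreal (\<Prod>b\<in>Basis. (u - l) \<bullet> b)"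
    by (simp add: prod_Basis_cart inner_axis)
qed simp

lemma det_matrix_conj_wo:
  fixes f :: "real ^ 'n::finite \<Rightarrow> real ^ 'n"
  shows "det (matrix (\<lambda>x. to_wo (f (of_wo x)))) = det (matrix f)"
proof -
  have ax: "of_wo (axis j 1) = axis (unWo j) (1 :: real)" for j :: "'n wo"
    by (auto simp: of_wo_def axis_def vec_eq_iff)
  have "matrix (\<lambda>x. to_wo (f (of_wo x))) = (\<chi> i j. matrix f $ unWo i $ unWo j)"
    by (simp add: matrix_def vec_eq_iff ax) (simp add: to_wo_def)
  then show ?thesis
    by (simp add: det_reindex_wo)
qed

text \<open>Conjugating \<open>\<phi>\<close> with \<open>to_wo\<close> leads to the ordered index
  type and changes neither Lebesgue measure nor the determinant. A Borel image has the same measure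
  in \<open>lebesgue\<close> and in \<open>lborel\<close>.\<close>

lemma emeasure_lborel_image:
  fixes \<phi> :: "real ^ 'n::finite \<Rightarrow> real ^ 'n"
  assumes S: "S \<in> sets borel"
    and der: "\<And>x. x \<in> S \<Longrightarrow> (\<phi> has_derivative \<phi>' x) (at x within S)"
    and inj: "inj_on \<phi> S"
    and cont: "continuous_on S (\<lambda>x. det (matrix (\<phi>' x)))"
    and im: "\<phi> ` S \<in> sets borel"
  shows "emeasure lborel (\<phi> ` S) =
    (\<integral>\<^sup>+ x. indicator S x * ennreal \<bar>det (matrix (\<phi>' x))\<bar> \<partial>lborel)"
proof -
  let ?S = "of_wo -` S" and ?\<psi> = "\<lambda>x. to_wo (\<phi> (of_wo x))"
    and ?\<psi>' = "\<lambda>x h. to_wo (\<phi>' (of_wo x) (of_wo h))"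
  have vimage: "f -` A = g ` A" if "\<And>x. f (g x) = x" "\<And>y. g (f y) = y"
    for f :: "'a \<Rightarrow> 'b" and g A
    using that by (metis (mono_tags, lifting) image_iff set_eqI vimageE vimageI2)
  have to_wo_vimage: "to_wo -` (?\<psi> ` ?S) = \<phi> ` S"
  proof -
    have "?\<psi> ` ?S = to_wo ` \<phi> ` S"
      by (subst vimage[of of_wo to_wo]) (auto simp: image_image)
    then show ?thesis
      by (subst vimage[of to_wo of_wo]) (auto simp: image_image)
  qed
  have "?\<psi> ` ?S = of_wo -` (\<phi> ` S)"
    by (subst (1 2) vimage[of of_wo to_wo]) (auto simp: image_image)
  then have im': "?\<psi> ` ?S \<in> sets borel"
    using measurable_sets[OF measurable_of_wo im] by simp
  have "emeasure lborel (\<phi> ` S) = emeasure (distr lborel borel to_wo) (?\<psi> ` ?S)"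
    by (subst emeasure_distr) (use im' in \<open>auto simp: to_wo_vimage\<close>)
  also have "\<dots> = emeasure lebesgue (?\<psi> ` ?S)"
    using im' by (simp add: distr_lborel_to_wo)
  also have "\<dots> = (\<integral>\<^sup>+ x. indicator ?S x * ennreal \<bar>det (matrix (?\<psi>' x))\<bar> \<partial>lborel)"
  proof (rule emeasure_lebesgue_image)
    show "?S \<in> sets borel"
      using measurable_sets[OF measurable_of_wo S] by simp
    show "inj_on ?\<psi> ?S"
    proof (rule inj_onI)
      fix x y assume *: "x \<in> ?S" "y \<in> ?S" "?\<psi> x = ?\<psi> y"
      then have "\<phi> (of_wo x) = \<phi> (of_wo y)"
        by (metis to_wo_of_wo(2))
      then have "of_wo x = of_wo y"
        using inj * by (auto dest: inj_onD)
      then show "x = y"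
        by (metis to_wo_of_wo(1))
    qed
    have der_of: "(of_wo has_derivative of_wo) F" for F :: "(real ^ 'n wo) filter"
      by (rule bounded_linear_imp_has_derivative)
        (rule linear_of_wo[unfolded linear_conv_bounded_linear])
    have der_to: "(to_wo has_derivative to_wo) F" for F :: "(real ^ 'n) filter"
      by (rule bounded_linear_imp_has_derivative)
        (rule linear_to_wo[unfolded linear_conv_bounded_linear])
    show "(?\<psi> has_derivative ?\<psi>' x) (at x within ?S)" if "x \<in> ?S" for x
    proof -
      have "(\<phi> has_derivative \<phi>' (of_wo x)) (at (of_wo x) within of_wo ` ?S)"
        by (rule has_derivative_subset[OF der]) (use that in auto)
      from diff_chain_within[OF der_of this]
      have "(\<phi> \<circ> of_wo has_derivative \<phi>' (of_wo x) \<circ> of_wo) (at x within ?S)" .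
      from diff_chain_within[OF this der_to]
      show ?thesis
        by (simp add: o_def)
    qed
    have "continuous_on ?S (\<lambda>x. det (matrix (\<phi>' (of_wo x))))"
      by (rule continuous_on_compose2[OF cont])
        (auto intro!: linear_continuous_on linear_of_wo[unfolded linear_conv_bounded_linear])
    then show "continuous_on ?S (\<lambda>x. det (matrix (?\<psi>' x)))"
      by (simp add: det_matrix_conj_wo)
  qed
  also have "\<dots> = (\<integral>\<^sup>+ x. indicator S (of_wo x) * ennreal \<bar>det (matrix (\<phi>' (of_wo x)))\<bar> \<partial>lborel)"
    by (simp add: det_matrix_conj_wo indicator_def)
  \<comment> \<open>The integrand depends on \<open>of_wo x\<close> only; reading
    \<open>lborel\<close> as the push-forward under \<open>to_wo\<close> cancels the
    relabelling.\<close>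
  also have "\<dots> = (\<integral>\<^sup>+ x. indicator S (of_wo x) * ennreal \<bar>det (matrix (\<phi>' (of_wo x)))\<bar>
      \<partial>distr lborel borel to_wo)"
    by (simp add: distr_lborel_to_wo)
  also have "\<dots> = (\<integral>\<^sup>+ x. indicator S x * ennreal \<bar>det (matrix (\<phi>' x))\<bar> \<partial>lborel)"
  proof -
    have "(\<lambda>x. indicator S x *\<^sub>R \<bar>det (matrix (\<phi>' x))\<bar>) \<in> borel_measurable borel"
      by (intro borel_measurable_continuous_on_indicator[OF S] continuous_on_rabs cont)
    moreover have "(\<lambda>x. indicator S x * ennreal \<bar>det (matrix (\<phi>' x))\<bar>) =
        (\<lambda>x. ennreal (indicator S x *\<^sub>R \<bar>det (matrix (\<phi>' x))\<bar>))"
      by (auto simp: fun_eq_iff indicator_def)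
    ultimately have m: "(\<lambda>x. indicator S x * ennreal \<bar>det (matrix (\<phi>' x))\<bar>) \<in> borel_measurable borel"
      by simp
    have "(\<lambda>x. indicator S (of_wo x) * ennreal \<bar>det (matrix (\<phi>' (of_wo x)))\<bar>) \<in> borel_measurable borel"
      by (rule measurable_compose[OF measurable_of_wo m])
    then show ?thesis
      by (simp add: nn_integral_distr)
  qed
  finally show ?thesis .
qed

subsection \<open>Lebesgue measure on the model space\<close>

definition proj_model :: "'n::finite set \<Rightarrow> real ^ 'n \<Rightarrow> real ^ 'n" where
  "proj_model I x = (\<chi> i. if i \<in> I then x $ i else 0)"

text \<open>A cylinder: the coordinates in \<open>I\<close> are free, and each fibre of
  \<open>proj_model I\<close> has volume 1 in the remaining coordinates.\<close>

definition unit_cube :: "'n::finite set \<Rightarrow> (real ^ 'n) set" where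
  "unit_cube I = {x. \<forall>i. i \<notin> I \<longrightarrow> 0 \<le> x $ i \<and> x $ i \<le> 1}"

text \<open>The measure implicit in \<open>chart_integral\<close>, carried from
  \<open>I\<close>-indexed tuples to \<open>real ^ 'n\<close>; it is the unit point mass at 0 if
  \<open>I = {}\<close>.\<close>

definition model_measure :: "'n::finite set \<Rightarrow> (real ^ 'n) measure" where
  "model_measure I = distr (\<Pi>\<^sub>M i\<in>I. lborel) borel (\<lambda>x. \<chi> i. if i \<in> I then x i else 0)"

lemma sets_model_measure [simp, measurable_cong]: "sets (model_measure I) = sets borel"
  by (simp add: model_measure_def)

lemma space_model_measure [simp]: "space (model_measure I) = UNIV"
  by (simp add: model_measure_def)

lemma linear_proj_model: "linear (proj_model I)"
  by (rule linearI) (auto simp: proj_model_def vec_eq_iff)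

lemmas bounded_linear_proj_model = linear_proj_model[unfolded linear_conv_bounded_linear]

lemma measurable_proj_model [measurable]: "proj_model I \<in> borel \<rightarrow>\<^sub>M borel"
  by (intro borel_measurable_continuous_onI linear_continuous_on bounded_linear_proj_model)

lemma proj_model_in [simp]: "proj_model I x \<in> model_space I"
  by (simp add: proj_model_def model_space_def)

lemma proj_model_id: "x \<in> model_space I \<Longrightarrow> proj_model I x = x"
  by (auto simp: proj_model_def model_space_def vec_eq_iff)

lemma closed_unit_cube: "closed (unit_cube I)"
proof -
  have "unit_cube I = (\<Inter>i\<in>-I. {x. 0 \<le> x $ i} \<inter> {x. x $ i \<le> 1})"
    by (auto simp: unit_cube_def)
  also have "closed \<dots>"
    by (intro closed_INT ballI closed_Int closed_Collect_le continuous_intros)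
  finally show ?thesis .
qed

lemma unit_cube_borel [measurable]: "unit_cube I \<in> sets borel"
  using closed_unit_cube by (rule borel_closed)

lemma closed_model_space: "closed (model_space I :: (real ^ 'n::finite) set)"
proof -
  have "model_space I = (\<Inter>i\<in>-I. {x :: real ^ 'n. x $ i = 0})"
    by (auto simp: model_space_def)
  also have "closed \<dots>"
    by (intro closed_INT ballI closed_Collect_eq continuous_intros)
  finally show ?thesis .
qed

lemma subspace_model_space: "subspace (model_space I)"
  by (auto simp: model_space_def subspace_def)

text \<open>
  Thickening a subset of the model space by the unit cube in the remaining coordinates reduces
  integration over the model space to integration over the whole of \<open>real ^ 'n\<close>.
\<close>

lemma PiM_eq_distr_cube:
  "(\<Pi>\<^sub>M i\<in>I. lborel) =
    distr (density lborel (indicator (unit_cube I))) (\<Pi>\<^sub>M i\<in>I. lborel) (\<lambda>x :: real ^ 'n::finite. \<lambda>i\<in>I. x $ i)"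
    (is "_ = ?P")
proof (rule sym)
  interpret product_sigma_finite "\<lambda>_ :: 'n. lborel :: real measure" ..
  have meas: "(\<lambda>x :: real ^ 'n. \<lambda>i\<in>I. x $ i) \<in> borel \<rightarrow>\<^sub>M (\<Pi>\<^sub>M i\<in>I. lborel)"
    by (intro measurable_restrict) simp
  show "?P = (\<Pi>\<^sub>M i\<in>I. lborel)"
  proof (rule PiM_eqI)
    fix A :: "'n \<Rightarrow> real set" assume A: "\<And>i. i \<in> I \<Longrightarrow> A i \<in> sets lborel"
    \<comment> \<open>Each factor outside \<open>I\<close> is \<open>{0..1}\<close>, of length 1, so
      it drops out of the product of lengths below.\<close>
    define B where "B i = (if i \<in> I then A i else {0..1})" for i
    have B: "B i \<in> sets borel" for i
      using A by (auto simp: B_def)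
    let ?C = "{x :: real ^ 'n. \<forall>i. x $ i \<in> B i}"
    have "?C = (\<Inter>i. (\<lambda>x. x $ i) -` B i)"
      by auto
    also have "\<dots> \<in> sets borel"
      by (intro sets.finite_INT) (use measurable_sets[OF _ B, where M = borel and f = "\<lambda>x. x $ i" for i] in auto)
    finally have C: "?C \<in> sets borel" .
    have PA: "Pi\<^sub>E I A \<in> sets (\<Pi>\<^sub>M i\<in>I. lborel)"
      using A by (intro sets_PiM_I_finite) auto
    have "emeasure ?P (Pi\<^sub>E I A) =
        (\<integral>\<^sup>+ x. indicator (unit_cube I) x * indicator ((\<lambda>x. \<lambda>i\<in>I. x $ i) -` Pi\<^sub>E I A) x \<partial>lborel)"
      using meas PA measurable_sets[OF meas PA] by (simp add: emeasure_distr emeasure_density)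
    also have "\<dots> = (\<integral>\<^sup>+ x. indicator ?C x \<partial>lborel)"
    proof (rule nn_integral_cong)
      fix x :: "real ^ 'n"
      have "x \<in> ?C \<longleftrightarrow> x \<in> unit_cube I \<and> (\<lambda>i\<in>I. x $ i) \<in> Pi\<^sub>E I A"
        by (auto simp: B_def unit_cube_def PiE_iff split: if_splits)
      then show "indicator (unit_cube I) x * indicator ((\<lambda>x. \<lambda>i\<in>I. x $ i) -` Pi\<^sub>E I A) x =
          (indicator ?C x :: ennreal)"
        by (auto simp: indicator_def)
    qed
    also have "\<dots> = emeasure (distr (\<Pi>\<^sub>M i\<in>UNIV. lborel) borel vec_lambda) ?C"
      using C by (simp add: distr_lborel_vec)
    also have "\<dots> = emeasure (\<Pi>\<^sub>M i\<in>UNIV. lborel) (Pi\<^sub>E UNIV B)"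
    proof -
      have "vec_lambda -` ?C \<inter> space (\<Pi>\<^sub>M i\<in>UNIV. lborel) = Pi\<^sub>E UNIV B"
        by (auto simp: space_PiM PiE_iff)
      then show ?thesis
        using C by (simp add: emeasure_distr measurable_vec_lambda)
    qed
    also have "\<dots> = (\<Prod>i\<in>UNIV. emeasure lborel (B i))"
      using B by (simp add: emeasure_PiM)
    also have "\<dots> = (\<Prod>i\<in>I. emeasure lborel (A i))"
      by (rule prod.mono_neutral_cong_right) (auto simp: B_def)
    finally show "emeasure ?P (Pi\<^sub>E I A) = (\<Prod>i\<in>I. emeasure lborel (A i))" .
  qed simp_all
qed

lemma measurable_model_embedding:
  "(\<lambda>x. \<chi> i. if i \<in> I then x i else 0) \<in> (\<Pi>\<^sub>M i\<in>I. lborel) \<rightarrow>\<^sub>M (borel :: (real ^ 'n::finite) measure)"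
proof -
  have "(\<lambda>x. if i \<in> I then x i else (0 :: real)) \<in> borel_measurable (\<Pi>\<^sub>M i\<in>I. lborel)" for i
    by (cases "i \<in> I") auto
  then show ?thesis
    by (subst borel_measurable_euclidean_space) (auto simp: Basis_vec_def inner_axis)
qed

lemma model_measure_eq:
  "model_measure I = distr (density lborel (indicator (unit_cube I))) borel (proj_model I)"
proof -
  have m: "(\<lambda>x :: real ^ 'a. \<lambda>i\<in>I. x $ i) \<in> density lborel (indicator (unit_cube I)) \<rightarrow>\<^sub>M (\<Pi>\<^sub>M i\<in>I. lborel)"
    by (intro measurable_restrict) simp
  show ?thesis
    unfolding model_measure_def
    by (subst PiM_eq_distr_cube, subst distr_distr[OF measurable_model_embedding m])
      (simp add: o_def proj_model_def[abs_def] cong: if_cong)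
qed

lemma nn_integral_model_measure:
  assumes [measurable]: "f \<in> borel_measurable borel"
  shows "(\<integral>\<^sup>+ x. f x \<partial>model_measure I) = (\<integral>\<^sup>+ x. indicator (unit_cube I) x * f (proj_model I x) \<partial>lborel)"
  unfolding model_measure_eq by (simp add: nn_integral_distr nn_integral_density)

lemma emeasure_model_measure:
  assumes [measurable]: "E \<in> sets borel"
  shows "emeasure (model_measure I) E = emeasure lborel {x \<in> unit_cube I. proj_model I x \<in> E}"
proof -
  have "emeasure (model_measure I) E = (\<integral>\<^sup>+ x. indicator E x \<partial>model_measure I)"
    by simp
  also have "\<dots> = (\<integral>\<^sup>+ x. indicator (unit_cube I) x * indicator E (proj_model I x) \<partial>lborel)"
    by (rule nn_integral_model_measure) simp
  also have "\<dots> = (\<integral>\<^sup>+ x. indicator {x \<in> unit_cube I. proj_model I x \<in> E} x \<partial>lborel)"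
    by (rule nn_integral_cong) (auto simp: indicator_def)
  also have "\<dots> = emeasure lborel {x \<in> unit_cube I. proj_model I x \<in> E}"
    by (rule nn_integral_indicator) measurable
  finally show ?thesis .
qed

text \<open>The Jacobian of a map multiplied by the identity in the coordinates outside
  \<open>I\<close>. Projecting before applying \<open>f\<close> makes only its values on
  \<open>model_space I\<close> count, the only ones that a derivative within that space
  determines.\<close>

definition block_det :: "'n::finite set \<Rightarrow> (real ^ 'n \<Rightarrow> real ^ 'n) \<Rightarrow> real" where
  "block_det I f = det (matrix (\<lambda>h. f (proj_model I h) + (h - proj_model I h)))"

text \<open>\<open>\<phi>\<close> times the identity maps the unit cylinder over \<open>S\<close>
  onto the one over its image. The full-dimensional formula applies to this map, and the determinant
  is \<open>block_det\<close>.\<close>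

lemma emeasure_model_image:
  fixes \<phi> :: "real ^ 'n::finite \<Rightarrow> real ^ 'n"
  assumes S [measurable]: "S \<in> sets borel" and S_sub: "S \<subseteq> model_space I"
    and im_sub: "\<phi> ` S \<subseteq> model_space I"
    and der: "\<And>x. x \<in> S \<Longrightarrow> (\<phi> has_derivative \<phi>' x) (at x within S)"
    and inj: "inj_on \<phi> S"
    and cont: "continuous_on S (\<lambda>x. block_det I (\<phi>' x))"
    and im [measurable]: "\<phi> ` S \<in> sets borel"
  shows "emeasure (model_measure I) (\<phi> ` S) =
    (\<integral>\<^sup>+ x. indicator S x * ennreal \<bar>block_det I (\<phi>' x)\<bar> \<partial>model_measure I)"
proof -
  let ?p = "proj_model I"
  define \<Phi> where "\<Phi> x = \<phi> (?p x) + (x - ?p x)" for x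
  define \<Phi>' where "\<Phi>' x h = \<phi>' (?p x) (?p h) + (h - ?p h)" for x h
  define cyl where "cyl E = {x \<in> unit_cube I. ?p x \<in> E}" for E
  have p_add: "?p (x + y) = ?p x + ?p y" and p_diff: "?p (x - y) = ?p x - ?p y" for x y
    using linear_proj_model[of I] by (auto simp: linear_add linear_diff)
  \<comment> \<open>Membership in the unit cube depends only on the part complementary to the model
    space, which \<open>\<Phi>\<close> leaves fixed.\<close>
  have cube_shift: "x \<in> unit_cube I \<longleftrightarrow> y \<in> unit_cube I" if "x - ?p x = y - ?p y" for x y
  proof -
    have "x $ i = y $ i" if "i \<notin> I" for i
      using \<open>x - ?p x = y - ?p y\<close> that by (auto simp: vec_eq_iff proj_model_def dest: spec[of _ i])
    then show ?thesis
      by (auto simp: unit_cube_def)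
  qed
  have p\<Phi>: "?p (\<Phi> x) = \<phi> (?p x)" "\<Phi> x - ?p (\<Phi> x) = x - ?p x" if "?p x \<in> S" for x
  proof -
    show *: "?p (\<Phi> x) = \<phi> (?p x)"
      using that im_sub by (auto simp: \<Phi>_def p_add p_diff proj_model_id)
    show "\<Phi> x - ?p (\<Phi> x) = x - ?p x"
      unfolding * by (simp add: \<Phi>_def)
  qed
  have image: "\<Phi> ` cyl S = cyl (\<phi> ` S)"
  proof (intro equalityI subsetI)
    fix y assume "y \<in> \<Phi> ` cyl S"
    then obtain x where x: "x \<in> unit_cube I" "?p x \<in> S" "y = \<Phi> x"
      by (auto simp: cyl_def)
    then have "y \<in> unit_cube I"
      using cube_shift[of y x] p\<Phi>(2)[of x] by simp
    then show "y \<in> cyl (\<phi> ` S)"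
      using x p\<Phi>(1)[of x] by (simp add: cyl_def)
  next
    fix y assume y: "y \<in> cyl (\<phi> ` S)"
    then obtain e where e: "e \<in> S" "?p y = \<phi> e"
      by (auto simp: cyl_def)
    \<comment> \<open>The preimage keeps the complementary part of \<open>y\<close> and replaces its
      model part by \<open>e\<close>.\<close>
    define x where "x = e + (y - ?p y)"
    have "?p x = ?p e + (?p y - ?p (?p y))"
      by (simp only: x_def p_add p_diff)
    moreover have "?p e = e"
      using e S_sub by (auto intro: proj_model_id)
    ultimately have px: "?p x = e"
      using proj_model_id[OF proj_model_in, of I y] by simp
    then have "x - ?p x = y - ?p y"
      by (simp add: x_def)
    then have "x \<in> cyl S"
      using cube_shift[of x y] y e px by (auto simp: cyl_def)
    moreover have "\<Phi> x = y"
      using px e by (simp add: \<Phi>_def) (simp add: x_def)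
    ultimately show "y \<in> \<Phi> ` cyl S"
      by blast
  qed
  have "emeasure (model_measure I) (\<phi> ` S) = emeasure lborel (\<Phi> ` cyl S)"
    unfolding image by (simp add: emeasure_model_measure cyl_def)
  also have "\<dots> = (\<integral>\<^sup>+ x. indicator (cyl S) x * ennreal \<bar>det (matrix (\<Phi>' x))\<bar> \<partial>lborel)"
  proof (rule emeasure_lborel_image)
    show "cyl S \<in> sets borel"
      unfolding cyl_def by measurable
    show "\<Phi> ` cyl S \<in> sets borel"
      unfolding image unfolding cyl_def by measurable
    show "inj_on \<Phi> (cyl S)"
    proof (rule inj_onI)
      fix x y assume *: "x \<in> cyl S" "y \<in> cyl S" "\<Phi> x = \<Phi> y"
      then have "\<phi> (?p x) = \<phi> (?p y)"
        using p\<Phi>(1)[of x] p\<Phi>(1)[of y] by (simp add: cyl_def)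
      then have "?p x = ?p y"
        using * inj by (auto simp: cyl_def dest: inj_onD)
      then show "x = y"
        using \<open>\<Phi> x = \<Phi> y\<close> by (simp add: \<Phi>_def)
    qed
    have "continuous_on (cyl S) (\<lambda>x. block_det I (\<phi>' (?p x)))"
      by (rule continuous_on_compose2[OF cont])
        (auto simp: cyl_def intro!: linear_continuous_on bounded_linear_proj_model)
    then show "continuous_on (cyl S) (\<lambda>x. det (matrix (\<Phi>' x)))"
      by (simp add: block_det_def \<Phi>'_def[abs_def])
    have der_p: "(?p has_derivative ?p) F" for F
      by (rule bounded_linear_imp_has_derivative) (rule bounded_linear_proj_model)
    show "(\<Phi> has_derivative \<Phi>' x) (at x within cyl S)" if "x \<in> cyl S" for x
    proof -
      have "(\<phi> has_derivative \<phi>' (?p x)) (at (?p x) within ?p ` cyl S)"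
        by (rule has_derivative_subset[OF der]) (use that in \<open>auto simp: cyl_def\<close>)
      from diff_chain_within[OF der_p this]
      have "((\<lambda>x. \<phi> (?p x)) has_derivative (\<lambda>h. \<phi>' (?p x) (?p h))) (at x within cyl S)"
        by (simp add: o_def)
      then show ?thesis
        unfolding \<Phi>_def[abs_def] \<Phi>'_def[abs_def]
        by (intro has_derivative_add has_derivative_diff has_derivative_ident der_p)
    qed
  qed
  also have "\<dots> = (\<integral>\<^sup>+ x. indicator (unit_cube I) x * (indicator S (?p x) * ennreal \<bar>block_det I (\<phi>' (?p x))\<bar>) \<partial>lborel)"
    by (rule nn_integral_cong) (auto simp: cyl_def indicator_def block_det_def \<Phi>'_def[abs_def])
  also have "\<dots> = (\<integral>\<^sup>+ x. indicator S x * ennreal \<bar>block_det I (\<phi>' x)\<bar> \<partial>model_measure I)"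
  proof (rule nn_integral_model_measure[symmetric])
    have "(\<lambda>x. indicator S x *\<^sub>R \<bar>block_det I (\<phi>' x)\<bar>) \<in> borel_measurable borel"
      by (intro borel_measurable_continuous_on_indicator[OF S] continuous_on_rabs cont)
    moreover have "(\<lambda>x. indicator S x * ennreal \<bar>block_det I (\<phi>' x)\<bar>) =
        (\<lambda>x. ennreal (indicator S x *\<^sub>R \<bar>block_det I (\<phi>' x)\<bar>))"
      by (auto simp: fun_eq_iff indicator_def)
    ultimately show "(\<lambda>x. indicator S x * ennreal \<bar>block_det I (\<phi>' x)\<bar>) \<in> borel_measurable borel"
      by simp
  qed
  finally show ?thesis .
qed

text \<open>Passage from sets to integrands: the restriction of \<open>model_measure I\<close> to
  the image equals the push-forward of the Jacobian density. On a Borel set \<open>B\<close> this is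
  the set formula for the part of \<open>S\<close> mapped into \<open>B\<close>.\<close>

lemma nn_integral_model_image:
  fixes \<phi> :: "real ^ 'n::finite \<Rightarrow> real ^ 'n"
  assumes S [measurable]: "S \<in> sets borel" and S_sub: "S \<subseteq> model_space I"
    and im_sub: "\<phi> ` S \<subseteq> model_space I"
    and der: "\<And>x. x \<in> S \<Longrightarrow> (\<phi> has_derivative \<phi>' x) (at x within S)"
    and inj: "inj_on \<phi> S"
    and cont: "continuous_on S (\<lambda>x. block_det I (\<phi>' x))"
    and im [measurable]: "\<phi> ` S \<in> sets borel"
    and F [measurable]: "F \<in> borel_measurable borel"
  shows "(\<integral>\<^sup>+ z. indicator (\<phi> ` S) z * F z \<partial>model_measure I) =
    (\<integral>\<^sup>+ x. indicator S x * (ennreal \<bar>block_det I (\<phi>' x)\<bar> * F (\<phi> x)) \<partial>model_measure I)"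
proof -
  \<comment> \<open>Extension by 0 outside \<open>S\<close> makes both functions Borel on the whole
    space. The value chosen for \<open>\<psi>\<close> is harmless because \<open>D\<close> vanishes
    there.\<close>
  define \<psi> where "\<psi> x = indicator S x *\<^sub>R \<phi> x" for x
  define D where "D x = indicator S x *\<^sub>R \<bar>block_det I (\<phi>' x)\<bar>" for x
  have D[measurable]: "D \<in> borel_measurable borel"
    unfolding D_def by (intro borel_measurable_continuous_on_indicator[OF S] continuous_on_rabs cont)
  have \<phi>_cont: "continuous_on S \<phi>"
    using der by (meson continuous_on_eq_continuous_within has_derivative_continuous)
  have \<psi>[measurable]: "\<psi> \<in> borel_measurable borel"
    unfolding \<psi>_def by (intro borel_measurable_continuous_on_indicator[OF S] \<phi>_cont)
  have "density (model_measure I) (indicator (\<phi> ` S)) = distr (density (model_measure I) D) borel \<psi>"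
  proof (rule measure_eqI)
    fix B assume "B \<in> sets (density (model_measure I) (indicator (\<phi> ` S)))"
    then have B[measurable]: "B \<in> sets borel"
      by simp
    let ?E = "S \<inter> \<psi> -` B"
    have E: "?E \<in> sets borel"
      using measurable_sets[OF \<psi> B] by simp
    have E_eq: "\<phi> ` ?E = \<phi> ` S \<inter> B"
      by (auto simp: \<psi>_def)
    have "emeasure (density (model_measure I) (indicator (\<phi> ` S))) B =
        (\<integral>\<^sup>+ x. indicator (\<phi> ` S) x * indicator B x \<partial>model_measure I)"
      by (rule emeasure_density) simp_all
    also have "\<dots> = (\<integral>\<^sup>+ x. indicator (\<phi> ` ?E) x \<partial>model_measure I)"
      unfolding E_eq by (simp add: indicator_inter_arith)
    also have "\<dots> = emeasure (model_measure I) (\<phi> ` ?E)"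
      by (rule nn_integral_indicator) (simp add: E_eq)
    also have "\<dots> = (\<integral>\<^sup>+ x. indicator ?E x * ennreal \<bar>block_det I (\<phi>' x)\<bar> \<partial>model_measure I)"
    proof (rule emeasure_model_image[OF E])
      show "?E \<subseteq> model_space I" "\<phi> ` ?E \<subseteq> model_space I"
        using S_sub im_sub by auto
      show "(\<phi> has_derivative \<phi>' x) (at x within ?E)" if "x \<in> ?E" for x
        by (rule has_derivative_subset[OF der]) (use that in auto)
      show "inj_on \<phi> ?E"
        using inj by (rule inj_on_subset) auto
      show "continuous_on ?E (\<lambda>x. block_det I (\<phi>' x))"
        using cont by (rule continuous_on_subset) auto
      show "\<phi> ` ?E \<in> sets borel"
        unfolding E_eq by measurable
    qed
    also have "\<dots> = (\<integral>\<^sup>+ x. ennreal (D x) * indicator B (\<psi> x) \<partial>model_measure I)"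
      by (rule nn_integral_cong) (auto simp: D_def indicator_def)
    also have "\<dots> = emeasure (distr (density (model_measure I) D) borel \<psi>) B"
    proof -
      have "\<psi> -` B \<in> sets (model_measure I)"
        using measurable_sets[OF \<psi> B] by simp
      then have "emeasure (density (model_measure I) D) (\<psi> -` B) =
          (\<integral>\<^sup>+ x. ennreal (D x) * indicator (\<psi> -` B) x \<partial>model_measure I)"
        by (intro emeasure_density) simp_all
      then show ?thesis
        by (simp add: emeasure_distr indicator_def)
    qed
    finally show "emeasure (density (model_measure I) (indicator (\<phi> ` S))) B =
        emeasure (distr (density (model_measure I) D) borel \<psi>) B" .
  qed simp
  then have "(\<integral>\<^sup>+ z. F z \<partial>density (model_measure I) (indicator (\<phi> ` S))) =
      (\<integral>\<^sup>+ z. F z \<partial>distr (density (model_measure I) D) borel \<psi>)"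
    by simp
  then have "(\<integral>\<^sup>+ z. indicator (\<phi> ` S) z * F z \<partial>model_measure I) =
      (\<integral>\<^sup>+ x. ennreal (D x) * F (\<psi> x) \<partial>model_measure I)"
    by (simp add: nn_integral_density nn_integral_distr)
  also have "\<dots> = (\<integral>\<^sup>+ x. indicator S x * (ennreal \<bar>block_det I (\<phi>' x)\<bar> * F (\<phi> x)) \<partial>model_measure I)"
    by (rule nn_integral_cong) (auto simp: D_def \<psi>_def indicator_def)
  finally show ?thesis .
qed

subsection \<open>Radon measures on locally compact second countable spaces\<close>

lemma borel_measure_openin: "borel_measure M N \<Longrightarrow> openin M U \<Longrightarrow> U \<in> sets N"
  by (auto simp: borel_measure_def)

lemma borel_measure_closedin: "borel_measure M N \<Longrightarrow> closedin M F \<Longrightarrow> F \<in> sets N"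
  by (metis borel_measure_def borel_measure_openin closedin_def double_diff openin_subset
      order_refl sets.compl_sets)

lemma borel_measurable_continuous_map:
  assumes "borel_measure M N" "continuous_map M euclideanreal f"
  shows "f \<in> borel_measurable N"
proof (rule borel_measurableI)
  fix S :: "real set" assume "open S"
  then have "openin M {x \<in> topspace M. f x \<in> S}"
    using assms(2) by (auto intro: openin_continuous_map_preimage)
  moreover have "f -` S \<inter> space N = {x \<in> topspace M. f x \<in> S}"
    using assms(1) by (auto simp: borel_measure_def)
  ultimately show "f -` S \<inter> space N \<in> sets N"
    using borel_measure_openin[OF assms(1)] by simp
qed

lemma Cc_outside_supp:
  assumes "x \<in> topspace M" "x \<notin> supp M f"
  shows "f x = 0"
  using assms closure_of_subset[of "{q \<in> topspace M. f q \<noteq> 0}" M] by (auto simp: supp_def)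

locale locally_compact_second_countable =
  fixes M :: "'m topology"
  assumes Hausdorff: "Hausdorff_space M"
    and second_countable: "second_countable M"
    and locally_compact: "locally_compact_space M"
begin

lemma completely_regular: "completely_regular_space M"
  using locally_compact_regular_imp_completely_regular_space locally_compact Hausdorff by blast

lemma compact_neighbourhood:
  assumes "openin M U" "x \<in> U"
  obtains W K where "openin M W" "compactin M K" "x \<in> W" "W \<subseteq> K" "K \<subseteq> U"
proof -
  have "neighbourhood_base_of (compactin M) M"
    using locally_compact_space_neighbourhood_base Hausdorff locally_compact by blast
  then show ?thesis
    using assms that unfolding neighbourhood_base_of by metis
qed

lemma open_countable_union_relatively_compact:
  assumes U: "openin M U"
  obtains W K :: "nat \<Rightarrow> 'm set" where
    "\<And>n. openin M (W n)" "\<And>n. compactin M (K n)" "\<And>n. W n \<subseteq> K n" "\<And>n. K n \<subseteq> U" "(\<Union>n. W n) = U"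
proof -
  obtain \<B> where \<B>: "countable \<B>" "\<And>V. V \<in> \<B> \<Longrightarrow> openin M V"
      "\<And>U x. openin M U \<Longrightarrow> x \<in> U \<Longrightarrow> \<exists>V\<in>\<B>. x \<in> V \<and> V \<subseteq> U"
    using second_countable unfolding second_countable_def by metis
  \<comment> \<open>The inserted \<open>{}\<close> gives \<open>from_nat_into\<close> a nonempty
    family even when no basis element qualifies.\<close>
  define \<C> where "\<C> = insert {} {V \<in> \<B>. \<exists>K. compactin M K \<and> V \<subseteq> K \<and> K \<subseteq> U}"
  have \<C>: "countable \<C>" "\<C> \<noteq> {}"
    using \<B>(1) by (auto simp: \<C>_def)
  have K: "\<exists>K. compactin M K \<and> V \<subseteq> K \<and> K \<subseteq> U" if "V \<in> \<C>" for V
    using that unfolding \<C>_def by (auto intro: exI[of _ "{}"])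
  then obtain k where k: "\<And>V. V \<in> \<C> \<Longrightarrow> compactin M (k V) \<and> V \<subseteq> k V \<and> k V \<subseteq> U"
    by metis
  have Un: "\<Union>\<C> = U"
  proof (intro equalityI subsetI)
    fix x assume "x \<in> U"
    then obtain W K where WK: "openin M W" "compactin M K" "x \<in> W" "W \<subseteq> K" "K \<subseteq> U"
      using compact_neighbourhood[OF U] by metis
    then obtain V where "V \<in> \<B>" "x \<in> V" "V \<subseteq> W"
      using \<B>(3) by metis
    moreover have "V \<subseteq> K"
      using \<open>V \<subseteq> W\<close> WK(4) by (rule order_trans)
    ultimately have "V \<in> \<C>"
      using WK(2,5) by (auto simp: \<C>_def)
    then show "x \<in> \<Union>\<C>"
      using \<open>x \<in> V\<close> by (rule UnionI)
  qed (use K in auto)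
  have from_nat: "from_nat_into \<C> n \<in> \<C>" for n
    using \<C>(2) by (rule from_nat_into)
  show ?thesis
  proof (rule that[of "from_nat_into \<C>" "\<lambda>n. k (from_nat_into \<C> n)"])
    show "openin M (from_nat_into \<C> n)" for n
      using from_nat[of n] \<B>(2) by (auto simp: \<C>_def)
    show "(\<Union>n. from_nat_into \<C> n) = U"
      using \<C> Un by simp
  qed (use k[OF from_nat] in auto)
qed

lemma open_sigma_compact:
  assumes U: "openin M U"
  obtains K :: "nat \<Rightarrow> 'm set" where "\<And>n. compactin M (K n)" "incseq K" "(\<Union>n. K n) = U"
proof -
  obtain W K where WK: "\<And>n::nat. openin M (W n)" "\<And>n. compactin M (K n)" "\<And>n. W n \<subseteq> K n"
      "\<And>n. K n \<subseteq> U" "(\<Union>n. W n) = U"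
    using open_countable_union_relatively_compact[OF U] by metis
  show ?thesis
  proof (rule that[of "\<lambda>n. \<Union>i\<in>{..n}. K i"])
    show "compactin M (\<Union>i\<in>{..n}. K i)" for n
      by (rule compactin_Union) (use WK in auto)
    show "incseq (\<lambda>n. \<Union>i\<in>{..n}. K i)"
      by (force simp: incseq_def)
    show "(\<Union>n. \<Union>i\<in>{..n}. K i) = U"
      using WK(3,4,5) by blast
  qed
qed

lemma compact_between:
  assumes K: "compactin M K" and U: "openin M U" "K \<subseteq> U"
  obtains V C where "openin M V" "compactin M C" "K \<subseteq> V" "V \<subseteq> C" "C \<subseteq> U"
proof -
  have "\<exists>W C. openin M W \<and> compactin M C \<and> x \<in> W \<and> W \<subseteq> C \<and> C \<subseteq> U" if "x \<in> K" for x
    using compact_neighbourhood[OF U(1), of x] that U(2) by (metis subsetD)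
  then obtain W C where WC: "\<And>x. x \<in> K \<Longrightarrow> openin M (W x) \<and> compactin M (C x) \<and> x \<in> W x \<and> W x \<subseteq> C x \<and> C x \<subseteq> U"
    by metis
  have "\<exists>\<F>. finite \<F> \<and> \<F> \<subseteq> W ` K \<and> K \<subseteq> \<Union>\<F>"
    by (rule compactinD[OF K]) (use WC in auto)
  then obtain F where F: "finite F" "F \<subseteq> K" "K \<subseteq> (\<Union>x\<in>F. W x)"
    by (metis finite_subset_image)
  show ?thesis
  proof (rule that[of "\<Union>x\<in>F. W x" "\<Union>x\<in>F. C x"])
    show "openin M (\<Union>x\<in>F. W x)"
      using WC F by blast
    show "compactin M (\<Union>x\<in>F. C x)"
      by (rule compactin_Union) (use WC F in auto)
    show "(\<Union>x\<in>F. W x) \<subseteq> (\<Union>x\<in>F. C x)" "(\<Union>x\<in>F. C x) \<subseteq> U"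
      using WC F(2) by blast+
  qed (use F in auto)
qed

text \<open>Vanishing off \<open>V\<close> only confines the support to the closure of
  \<open>V\<close>. The compact, hence closed, set \<open>C\<close> between \<open>V\<close> and
  \<open>U\<close> keeps this closure compact and inside \<open>U\<close>.\<close>

lemma cutoff_function:
  assumes K: "compactin M K" and U: "openin M U" "K \<subseteq> U"
  obtains f where "f \<in> Cc M" "\<And>x. x \<in> topspace M \<Longrightarrow> 0 \<le> f x \<and> f x \<le> 1" "\<And>x. x \<in> K \<Longrightarrow> f x = 1"
    "supp M f \<subseteq> U"
proof -
  obtain V C where VC: "openin M V" "compactin M C" "K \<subseteq> V" "V \<subseteq> C" "C \<subseteq> U"
    using compact_between[OF K U] by metis
  have "closedin M (topspace M - V)"
    using VC(1) by blast
  moreover have "disjnt K (topspace M - V)"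
    using VC(3) by (auto simp: disjnt_def)
  ultimately obtain f where f: "continuous_map M (top_of_set {0..1::real}) f"
      "f ` (topspace M - V) \<subseteq> {0}" "f ` K \<subseteq> {1}"
    using Urysohn_completely_regular_compact_closed[of 0 1, OF _ completely_regular K] by auto
  have "closedin M C"
    using VC(2) Hausdorff by (rule compactin_imp_closedin[rotated])
  moreover have "{q \<in> topspace M. f q \<noteq> 0} \<subseteq> C"
    using f(2) VC(4) by blast
  ultimately have supp: "supp M f \<subseteq> C"
    unfolding supp_def by (rule closure_of_minimal[rotated])
  have "compactin M (supp M f)"
    using closed_compactin[OF VC(2) supp] by (simp add: supp_def)
  then have "f \<in> Cc M"
    using f(1) by (simp add: Cc_def continuous_map_into_fulltopology)
  moreover have "0 \<le> f x \<and> f x \<le> 1" if "x \<in> topspace M" for x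
    using f(1) that by (auto simp: continuous_map_in_subtopology)
  ultimately show ?thesis
    using f(3) supp VC(5) by (intro that[of f]) auto
qed

section \<open>Integrals of compactly supported functions and uniqueness\<close>

lemma integrable_Cc:
  assumes N: "borel_measure M N" "\<And>K. compactin M K \<Longrightarrow> emeasure N K < \<infinity>" and f: "f \<in> Cc M"
  shows "integrable N f"
proof -
  let ?S = "supp M f"
  have S: "compactin M ?S" and cont: "continuous_map M euclideanreal f"
    using f by (auto simp: Cc_def)
  have "compact (f ` ?S)"
    using image_compactin[OF S cont] by simp
  then obtain B where B: "\<And>x. x \<in> ?S \<Longrightarrow> norm (f x) \<le> B"
    by (metis compact_imp_bounded bounded_iff imageI)
  show ?thesis
  proof (rule integrableI_bounded_set[where A = ?S and B = B])
    show "?S \<in> sets N"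
      using N(1) by (rule borel_measure_closedin) (simp add: supp_def)
    show "f \<in> borel_measurable N"
      using N(1) cont by (rule borel_measurable_continuous_map)
    show "emeasure N ?S < \<infinity>"
      using S by (rule N(2))
    show "AE x in N. x \<notin> ?S \<longrightarrow> f x = 0"
      using N(1) by (intro AE_I2) (auto simp: borel_measure_def intro: Cc_outside_supp)
  qed (use B in auto)
qed

text \<open>A cutoff \<open>f\<close> between the indicators of a compact \<open>K\<close> and of
  \<open>U\<close> bounds the \<open>N1\<close>-measure of \<open>K\<close> by the
  \<open>N2\<close>-measure of \<open>U\<close>; inner regularity of \<open>N1\<close> on
  \<open>U\<close> takes the supremum over \<open>K\<close>.\<close>

lemma radon_measure_unique_open_le:
  assumes N1: "regular_radon_measure M N1" and N2: "regular_radon_measure M N2"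
    and eq: "\<And>f. f \<in> Cc M \<Longrightarrow> (\<integral>q. f q \<partial>N1) = (\<integral>q. f q \<partial>N2)"
    and U: "openin M U"
  shows "emeasure N1 U \<le> emeasure N2 U"
proof -
  have B1: "borel_measure M N1" "\<And>K. compactin M K \<Longrightarrow> emeasure N1 K < \<infinity>"
    and B2: "borel_measure M N2" "\<And>K. compactin M K \<Longrightarrow> emeasure N2 K < \<infinity>"
    using N1 N2 by (auto simp: regular_radon_measure_def radon_measure_def)
  have sp: "space N1 = topspace M" "space N2 = topspace M"
    using B1(1) B2(1) by (auto simp: borel_measure_def)
  have le: "emeasure N1 K \<le> emeasure N2 U" if K: "compactin M K" "K \<subseteq> U" for K
  proof -
    obtain f where f: "f \<in> Cc M" "\<And>x. x \<in> topspace M \<Longrightarrow> 0 \<le> f x \<and> f x \<le> 1"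
        "\<And>x. x \<in> K \<Longrightarrow> f x = 1" "supp M f \<subseteq> U"
      using cutoff_function[OF K(1) U K(2)] by metis
    have K1: "K \<in> sets N1"
      by (rule borel_measure_closedin[OF B1(1) compactin_imp_closedin[OF Hausdorff K(1)]])
    have U2: "U \<in> sets N2"
      by (rule borel_measure_openin[OF B2(1) U])
    have "emeasure N1 K = (\<integral>\<^sup>+ x. indicator K x \<partial>N1)"
      using K1 by simp
    also have "\<dots> \<le> (\<integral>\<^sup>+ x. ennreal (f x) \<partial>N1)"
      by (rule nn_integral_mono) (use f in \<open>auto simp: indicator_def\<close>)
    also have "\<dots> = ennreal (\<integral>q. f q \<partial>N1)"
      by (rule nn_integral_eq_integral[OF integrable_Cc[OF B1 f(1)]]) (use f(2) sp in auto)
    also have "\<dots> = ennreal (\<integral>q. f q \<partial>N2)"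
      by (simp add: eq f(1))
    also have "\<dots> = (\<integral>\<^sup>+ x. ennreal (f x) \<partial>N2)"
      by (rule nn_integral_eq_integral[OF integrable_Cc[OF B2 f(1)], symmetric]) (use f(2) sp in auto)
    also have "\<dots> \<le> (\<integral>\<^sup>+ x. indicator U x \<partial>N2)"
    proof (rule nn_integral_mono)
      fix x assume "x \<in> space N2"
      then have x: "x \<in> topspace M"
        using sp by simp
      show "ennreal (f x) \<le> indicator U x"
        using f(2)[OF x] Cc_outside_supp[OF x, of f] f(4) by (auto simp: indicator_def)
    qed
    also have "\<dots> = emeasure N2 U"
      using U2 by simp
    finally show ?thesis .
  qed
  have "emeasure N1 U = (SUP K \<in> {K. compactin M K \<and> K \<subseteq> U}. emeasure N1 K)"
    using N1 U by (auto simp: regular_radon_measure_def radon_measure_def inner_regular_at_def)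
  also have "\<dots> \<le> emeasure N2 U"
    by (rule SUP_least) (use le in auto)
  finally show ?thesis .
qed

text \<open>The preceding bound, used in both directions, settles open sets, and outer regularity
  extends the equality to Borel sets.\<close>

lemma regular_radon_measure_unique:
  assumes N1: "regular_radon_measure M N1" and N2: "regular_radon_measure M N2"
    and eq: "\<And>f. f \<in> Cc M \<Longrightarrow> (\<integral>q. f q \<partial>N1) = (\<integral>q. f q \<partial>N2)"
  shows "N1 = N2"
proof (rule measure_eqI)
  have s: "sets N1 = sets N2"
    using N1 N2 by (auto simp: regular_radon_measure_def radon_measure_def borel_measure_def)
  then show "sets N1 = sets N2" .
  fix E assume E: "E \<in> sets N1"
  have "emeasure N1 U = emeasure N2 U" if "openin M U" for U
    using radon_measure_unique_open_le[OF N1 N2 eq that]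
      radon_measure_unique_open_le[OF N2 N1 eq[symmetric] that] by (rule antisym)
  moreover have "emeasure N1 E = (INF U \<in> {U. openin M U \<and> E \<subseteq> U}. emeasure N1 U)"
    "emeasure N2 E = (INF U \<in> {U. openin M U \<and> E \<subseteq> U}. emeasure N2 U)"
    using N1 N2 E s by (auto simp: regular_radon_measure_def outer_regular_at_def)
  ultimately show "emeasure N1 E = emeasure N2 E"
    by simp
qed

section \<open>Regularity of Borel measures finite on compact sets\<close>

text \<open>The sets that can be squeezed in this way form a \<sigma>-algebra; closed rather than
  compact inner sets make the condition symmetric under complements. Open sets qualify because they
  are \<sigma>-compact.\<close>

lemma finite_measure_closed_open_approx:
  assumes N: "borel_measure M N" "emeasure N (topspace M) < \<infinity>"
    and E: "E \<in> sets N" and e: "0 < e"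
  shows "\<exists>F U. closedin M F \<and> openin M U \<and> F \<subseteq> E \<and> E \<subseteq> U \<and> measure N (U - F) < e"
proof -
  interpret finite_measure N
    by standard (use N in \<open>auto simp: borel_measure_def\<close>)
  have "E \<in> sigma_sets (topspace M) {U. openin M U}"
    using E N(1) by (simp add: borel_measure_def)
  then show ?thesis
    using e
  proof (induction E arbitrary: e)
    case (Basic U)
    then have U: "openin M U"
      by simp
    obtain K where K: "\<And>n. compactin M (K n)" "incseq K" "(\<Union>n. K n) = U"
      using open_sigma_compact[OF U] by metis
    have closed: "closedin M (K n)" for n
      using K(1) Hausdorff by (rule compactin_imp_closedin[rotated])
    have sets: "range K \<subseteq> sets N" "U \<in> sets N"
      using borel_measure_closedin[OF N(1) closed] borel_measure_openin[OF N(1) U] by auto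
    have "(\<lambda>n. measure N (K n)) \<longlonglongrightarrow> measure N U"
      using finite_Lim_measure_incseq[OF sets(1) K(2)] K(3) by simp
    then have "\<forall>\<^sub>F n in sequentially. measure N U - e < measure N (K n)"
      by (rule order_tendstoD) (use Basic.prems in simp)
    then obtain n where "measure N U - e < measure N (K n)"
      by (auto simp: eventually_sequentially)
    moreover have "measure N (U - K n) = measure N U - measure N (K n)"
      using sets K(3) by (intro finite_measure_Diff) auto
    ultimately show ?case
      using U closed[of n] K(3) by (intro exI[of _ "K n"] exI[of _ U]) auto
  next
    case Empty
    then show ?case
      by (intro exI[of _ "{}"]) auto
  next
    case (Compl A)
    then obtain F U where FU: "closedin M F" "openin M U" "F \<subseteq> A" "A \<subseteq> U" "measure N (U - F) < e"
      using Compl.IH[OF Compl.prems] by metis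
    have "(topspace M - F) - (topspace M - U) = U - F"
      using openin_subset[OF FU(2)] by auto
    then show ?case
      using FU by (intro exI[of _ "topspace M - U"] exI[of _ "topspace M - F"]) auto
  next
    case (Union A)
    \<comment> \<open>These errors add up to \<open>e / 2\<close>. The remaining slack pays for
      truncating the union of the \<open>F i\<close>, which need not be closed as long as it is
      infinite.\<close>
    have "\<exists>F U. closedin M F \<and> openin M U \<and> F \<subseteq> A i \<and> A i \<subseteq> U \<and> measure N (U - F) < e / 2 * (1/2) ^ Suc i" for i
      by (rule Union.IH) (use Union.prems in simp)
    then obtain F U where FU: "\<And>i. closedin M (F i)" "\<And>i. openin M (U i)" "\<And>i. F i \<subseteq> A i" "\<And>i. A i \<subseteq> U i"
        "\<And>i. measure N (U i - F i) < e / 2 * (1/2) ^ Suc i"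
      by metis
    have sF: "F i \<in> sets N" and sU: "U i \<in> sets N" for i
      using borel_measure_closedin[OF N(1) FU(1)] borel_measure_openin[OF N(1) FU(2)] by auto
    let ?U = "\<Union>i. U i"
    have half: "(\<lambda>i. e / 2 * (1/2) ^ Suc i) sums (e / 2)"
      using sums_mult[OF power_half_series, of "e / 2"] by simp
    have summable: "summable (\<lambda>i. measure N (U i - F i))"
      by (rule summable_comparison_test'[OF sums_summable[OF half], of 0]) (use FU(5) in \<open>auto intro: less_imp_le\<close>)
    have "measure N (?U - (\<Union>i. F i)) \<le> measure N (\<Union>i. U i - F i)"
      using sF sU by (intro finite_measure_mono) auto
    also have "\<dots> \<le> (\<Sum>i. measure N (U i - F i))"
      by (rule finite_measure_subadditive_countably) (use sF sU summable in auto)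
    also have "\<dots> \<le> (\<Sum>i. e / 2 * (1/2) ^ Suc i)"
      by (rule suminf_le[OF _ summable sums_summable[OF half]]) (use FU(5) less_imp_le in blast)
    also have "\<dots> = e / 2"
      using half by (rule sums_unique[symmetric])
    finally have le: "measure N (?U - (\<Union>i. F i)) < e"
      using Union.prems by simp
    \<comment> \<open>Continuity from above, valid because \<open>N\<close> is finite, yields a
      finite and hence closed union whose error is still below \<open>e\<close>.\<close>
    have "(\<lambda>n. measure N (?U - (\<Union>i\<in>{..n}. F i))) \<longlonglongrightarrow> measure N (\<Inter>n. ?U - (\<Union>i\<in>{..n}. F i))"
    proof (rule finite_Lim_measure_decseq)
      show "range (\<lambda>n. ?U - (\<Union>i\<in>{..n}. F i)) \<subseteq> sets N"
        using sF sU by auto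
      show "decseq (\<lambda>n. ?U - (\<Union>i\<in>{..n}. F i))"
        by (force simp: decseq_def)
    qed
    moreover have "(\<Inter>n. ?U - (\<Union>i\<in>{..n}. F i)) = ?U - (\<Union>i. F i)"
      by auto
    ultimately have "(\<lambda>n. measure N (?U - (\<Union>i\<in>{..n}. F i))) \<longlonglongrightarrow> measure N (?U - (\<Union>i. F i))"
      by simp
    then have "\<forall>\<^sub>F n in sequentially. measure N (?U - (\<Union>i\<in>{..n}. F i)) < e"
      by (rule order_tendstoD) (rule le)
    then obtain n where n: "measure N (?U - (\<Union>i\<in>{..n}. F i)) < e"
      by (auto simp: eventually_sequentially)
    show ?case
    proof (intro exI conjI)
      show "closedin M (\<Union>i\<in>{..n}. F i)"
        using FU(1) by (intro closedin_Union) auto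
      show "openin M ?U"
        using FU(2) by blast
      show "(\<Union>i\<in>{..n}. F i) \<subseteq> \<Union> (range A)" "\<Union> (range A) \<subseteq> ?U"
        using FU(3,4) by blast+
    qed (rule n)
  qed
qed

text \<open>The restriction of \<open>N\<close> to a relatively compact \<open>W n\<close> is
  finite, so the finite case applies piece by piece. Bounding the measure of \<open>U - E\<close>,
  not a difference of measures, keeps the claim meaningful when \<open>E\<close> has infinite
  measure.\<close>

lemma open_approx:
  assumes N: "borel_measure M N" "\<And>K. compactin M K \<Longrightarrow> emeasure N K < \<infinity>"
    and E: "E \<in> sets N" and e: "0 < (e :: real)"
  shows "\<exists>U. openin M U \<and> E \<subseteq> U \<and> emeasure N (U - E) \<le> ennreal e"
proof -
  obtain W K where WK: "\<And>n::nat. openin M (W n)" "\<And>n. compactin M (K n)" "\<And>n. W n \<subseteq> K n"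
      "(\<Union>n. W n) = topspace M"
    using open_countable_union_relatively_compact[OF openin_topspace] by metis
  have sW: "W n \<in> sets N" for n
    using N(1) WK(1) by (rule borel_measure_openin)
  have space: "space N = topspace M"
    using N(1) by (simp add: borel_measure_def)
  have E_sub: "E \<subseteq> topspace M"
    using sets.sets_into_space[OF E] space by simp
  have "\<exists>V. openin M V \<and> E \<subseteq> V \<and> emeasure N (W n \<inter> (V - E)) \<le> ennreal (e * (1/2) ^ Suc n)" for n
  proof -
    \<comment> \<open>The restriction of \<open>N\<close> to \<open>W n\<close>, kept as a measure
      on all Borel sets of \<open>M\<close>.\<close>
    let ?N = "density N (indicator (W n))"
    have em: "emeasure ?N B = emeasure N (W n \<inter> B)" if "B \<in> sets N" for B
    proof -
      have "emeasure ?N B = (\<integral>\<^sup>+ x. indicator (W n) x * indicator B x \<partial>N)"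
        by (rule emeasure_density) (use sW that in auto)
      also have "\<dots> = (\<integral>\<^sup>+ x. indicator (W n \<inter> B) x \<partial>N)"
        by (simp add: indicator_inter_arith)
      also have "\<dots> = emeasure N (W n \<inter> B)"
        by (rule nn_integral_indicator) (use sW that in auto)
      finally show ?thesis .
    qed
    have "emeasure N (W n) \<le> emeasure N (K n)"
      by (rule emeasure_mono[OF WK(3)])
        (rule borel_measure_closedin[OF N(1) compactin_imp_closedin[OF Hausdorff WK(2)]])
    then have "emeasure ?N (topspace M) < \<infinity>"
      using N(2)[OF WK(2), of n] em[OF sets.top] openin_subset[OF WK(1), of n]
      by (simp add: space Int_absorb2 order.strict_trans1)
    moreover have "borel_measure M ?N"
      using N(1) by (simp add: borel_measure_def)
    ultimately obtain F V where FV: "closedin M F" "openin M V" "F \<subseteq> E" "E \<subseteq> V"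
        "measure ?N (V - F) < e * (1/2) ^ Suc n"
      using finite_measure_closed_open_approx[of ?N E "e * (1/2) ^ Suc n"] E e by auto
    interpret F: finite_measure ?N
      by standard (use \<open>emeasure ?N (topspace M) < \<infinity>\<close> space in auto)
    have sV: "V \<in> sets N" "F \<in> sets N"
      using borel_measure_openin[OF N(1) FV(2)] borel_measure_closedin[OF N(1) FV(1)] by auto
    have "emeasure N (W n \<inter> (V - E)) = emeasure ?N (V - E)"
      by (rule em[symmetric]) (use sV E in auto)
    also have "\<dots> \<le> emeasure ?N (V - F)"
      by (rule emeasure_mono) (use FV(3) sV in auto)
    also have "\<dots> \<le> ennreal (e * (1/2) ^ Suc n)"
      using FV(5) by (simp add: F.emeasure_eq_measure ennreal_leI)
    finally show ?thesis
      using FV by blast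
  qed
  then obtain V where V: "\<And>n. openin M (V n)" "\<And>n. E \<subseteq> V n"
      "\<And>n. emeasure N (W n \<inter> (V n - E)) \<le> ennreal (e * (1/2) ^ Suc n)"
    by metis
  \<comment> \<open>\<open>V n\<close> is controlled only inside \<open>W n\<close>, so just that
    part is kept; the \<open>W n\<close> cover \<open>M\<close>, hence the union still contains
    \<open>E\<close>.\<close>
  let ?U = "\<Union>n. W n \<inter> V n"
  have sV: "V n \<in> sets N" for n
    using N(1) V(1) by (rule borel_measure_openin)
  have "emeasure N (?U - E) = emeasure N (\<Union>n. W n \<inter> (V n - E))"
    by (rule arg_cong[where f = "emeasure N"]) auto
  also have "\<dots> \<le> (\<Sum>n. emeasure N (W n \<inter> (V n - E)))"
    by (rule emeasure_subadditive_countably) (use sW sV E in auto)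
  also have "\<dots> \<le> (\<Sum>n. ennreal (e * (1/2) ^ Suc n))"
    by (rule suminf_le[OF V(3)]) auto
  also have "\<dots> = ennreal e"
    by (rule suminf_ennreal_eq) (use e sums_mult[OF power_half_series, of e] in auto)
  finally have "emeasure N (?U - E) \<le> ennreal e" .
  moreover have "openin M ?U"
    using WK(1) V(1) by blast
  moreover have "E \<subseteq> ?U"
  proof
    fix x assume "x \<in> E"
    moreover from this obtain n where "x \<in> W n"
      using E_sub WK(4) by (metis UN_E subsetD)
    ultimately show "x \<in> ?U"
      using V(2)[of n] by auto
  qed
  ultimately show ?thesis
    by blast
qed

text \<open>Outer regularity is \<open>open_approx\<close>. Applied to the complement of
  \<open>E\<close>, it gives a closed subset of \<open>E\<close> with small remainder, and
  intersecting with a compact exhaustion of \<open>M\<close> replaces closed by compact.\<close>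

lemma regular_radon_measureI:
  assumes N: "borel_measure M N" "\<And>K. compactin M K \<Longrightarrow> emeasure N K < \<infinity>"
  shows "regular_radon_measure M N"
proof -
  have space: "space N = topspace M"
    using N(1) by (simp add: borel_measure_def)
  have outer: "outer_regular_at M N E" if E: "E \<in> sets N" for E
    unfolding outer_regular_at_def
  proof (rule antisym)
    show "emeasure N E \<le> (INF U \<in> {U. openin M U \<and> E \<subseteq> U}. emeasure N U)"
      by (rule INF_greatest) (auto intro: emeasure_mono borel_measure_openin[OF N(1)])
    show "(INF U \<in> {U. openin M U \<and> E \<subseteq> U}. emeasure N U) \<le> emeasure N E"
    proof (rule ennreal_le_epsilon)
      fix e :: real assume "0 < e"
      then obtain U where U: "openin M U" "E \<subseteq> U" "emeasure N (U - E) \<le> ennreal e"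
        using open_approx[OF N E] by blast
      have sU: "U \<in> sets N"
        by (rule borel_measure_openin[OF N(1) U(1)])
      have "(INF U \<in> {U. openin M U \<and> E \<subseteq> U}. emeasure N U) \<le> emeasure N U"
        by (rule INF_lower) (use U in auto)
      also have "U = E \<union> (U - E)"
        using U(2) by auto
      also have "emeasure N (E \<union> (U - E)) \<le> emeasure N E + emeasure N (U - E)"
        by (rule emeasure_subadditive) (use E sU in auto)
      also have "\<dots> \<le> emeasure N E + ennreal e"
        by (rule add_left_mono) (rule U(3))
      finally show "(INF U \<in> {U. openin M U \<and> E \<subseteq> U}. emeasure N U) \<le> emeasure N E + ennreal e" .
    qed
  qed
  have inner: "inner_regular_at M N E" if E: "E \<in> sets N" for E
    unfolding inner_regular_at_def
  proof (rule antisym)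
    let ?S = "SUP K \<in> {K. compactin M K \<and> K \<subseteq> E}. emeasure N K"
    show "?S \<le> emeasure N E"
      by (rule SUP_least) (use E in \<open>auto intro: emeasure_mono\<close>)
    show "emeasure N E \<le> ?S"
    proof (rule ennreal_le_epsilon)
      fix e :: real assume "0 < e"
      moreover have "topspace M - E \<in> sets N"
        using sets.compl_sets[OF E] space by simp
      ultimately obtain V where V: "openin M V" "topspace M - E \<subseteq> V"
          "emeasure N (V - (topspace M - E)) \<le> ennreal e"
        using open_approx[OF N] by blast
      let ?F = "topspace M - V"
      have F: "closedin M ?F"
        using V(1) by blast
      have FE: "?F \<subseteq> E"
        using V(2) by auto
      have sF: "?F \<in> sets N" and sV: "V \<in> sets N"
        using borel_measure_closedin[OF N(1) F] borel_measure_openin[OF N(1) V(1)] by auto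
      obtain K where K: "\<And>n. compactin M (K n)" "incseq K" "(\<Union>n. K n) = topspace M"
        using open_sigma_compact[OF openin_topspace] by metis
      have cK: "compactin M (?F \<inter> K n)" for n
        by (rule closed_Int_compactin[OF F K(1)])
      have "emeasure N ?F = emeasure N (\<Union>n. ?F \<inter> K n)"
        by (rule arg_cong[where f = "emeasure N"]) (use K(3) in auto)
      also have "\<dots> = (SUP n. emeasure N (?F \<inter> K n))"
      proof (rule SUP_emeasure_incseq[symmetric])
        show "range (\<lambda>n. ?F \<inter> K n) \<subseteq> sets N"
          using borel_measure_closedin[OF N(1) compactin_imp_closedin[OF Hausdorff cK]] by auto
        show "incseq (\<lambda>n. ?F \<inter> K n)"
          using K(2) by (auto simp: incseq_def)
      qed
      also have "\<dots> \<le> ?S"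
        by (rule SUP_mono) (use cK FE in auto)
      finally have "emeasure N ?F \<le> ?S" .
      moreover have "E \<subseteq> topspace M"
        using sets.sets_into_space[OF E] space by simp
      then have "E = ?F \<union> (V - (topspace M - E))"
        using FE openin_subset[OF V(1)] by auto
      then have "emeasure N E \<le> emeasure N ?F + emeasure N (V - (topspace M - E))"
        by (metis (no_types, lifting) emeasure_subadditive sF sV sets.Diff \<open>topspace M - E \<in> sets N\<close>)
      ultimately show "emeasure N E \<le> ?S + ennreal e"
        using V(3) by (meson add_mono order_trans)
    qed
  qed
  show ?thesis
    unfolding regular_radon_measure_def radon_measure_def
    using N outer inner borel_measure_openin[OF N(1)] by blast
qed

end

subsection \<open>Jacobians and coordinate frames\<close>

text \<open>\<open>S\<close> need not be open in \<open>real ^ 'n\<close>, so a derivative within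
  \<open>S\<close> is not unique on all vectors. A line through \<open>x\<close> in a direction of
  the model space stays in \<open>S\<close> for small parameters, which leaves an ordinary
  derivative in one variable.\<close>

lemma has_vector_derivative_model_direction:
  fixes f :: "real ^ 'n::finite \<Rightarrow> 'b::real_normed_vector"
  assumes S: "openin (top_of_set (model_space I)) S" and x: "x \<in> S" and v: "v \<in> model_space I"
    and D: "(f has_derivative D) (at x within S)"
  shows "((\<lambda>t. f (x + t *\<^sub>R v)) has_vector_derivative D v) (at 0)"
proof -
  obtain T where T: "open T" "S = model_space I \<inter> T"
    using S unfolding openin_open by blast
  let ?g = "\<lambda>t :: real. x + t *\<^sub>R v"
  have "x \<in> model_space I"
    using x T by simp
  then have vS: "?g -` S = ?g -` T"
    using T(2) v subspace_model_space[of I] by (auto intro: subspace_add subspace_scale)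
  have open_vS: "open (?g -` T)"
    by (rule open_vimage[OF T(1)]) (intro continuous_intros)
  have "(?g has_derivative (\<lambda>t. t *\<^sub>R v)) (at 0 within ?g -` S)"
    by (auto intro!: derivative_eq_intros)
  moreover have "(f has_derivative D) (at (?g 0) within ?g ` (?g -` S))"
    using has_derivative_subset[OF D, of "?g ` (?g -` S)"] by auto
  ultimately have "(f \<circ> ?g has_derivative D \<circ> (\<lambda>t. t *\<^sub>R v)) (at 0 within ?g -` S)"
    by (rule diff_chain_within)
  moreover have "D \<circ> (\<lambda>t. t *\<^sub>R v) = (\<lambda>t. t *\<^sub>R D v)"
    using linear_scale[OF has_derivative_linear[OF D]] by (simp add: fun_eq_iff)
  moreover have "at 0 within ?g -` S = at 0"
    unfolding vS by (rule at_within_open[OF _ open_vS]) (use x T in auto)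
  ultimately show ?thesis
    by (simp add: has_vector_derivative_def o_def)
qed

lemma has_derivative_model_unique:
  fixes f :: "real ^ 'n::finite \<Rightarrow> 'b::real_normed_vector"
  assumes S: "openin (top_of_set (model_space I)) S" and x: "x \<in> S" and v: "v \<in> model_space I"
    and "(f has_derivative D) (at x within S)" "(f has_derivative D') (at x within S)"
  shows "D v = D' v"
  using has_vector_derivative_model_direction[OF S x v] assms(4,5)
  by (blast intro: vector_derivative_unique_at)

text \<open>The components outside \<open>J\<close> vanish identically, hence so do their
  derivatives, by uniqueness in model directions.\<close>

lemma has_derivative_model_range:
  fixes f :: "real ^ 'n::finite \<Rightarrow> real ^ 'm::finite"
  assumes S: "openin (top_of_set (model_space I)) S" and x: "x \<in> S" and v: "v \<in> model_space I"
    and D: "(f has_derivative D) (at x within S)" and im: "f ` S \<subseteq> model_space J"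
  shows "D v \<in> model_space J"
proof -
  have "D v $ i = 0" if "i \<notin> J" for i
  proof -
    have "((\<lambda>y. f y $ i) has_derivative (\<lambda>h. D h $ i)) (at x within S)"
      by (rule bounded_linear.has_derivative[OF bounded_linear_vec_nth D])
    moreover have "((\<lambda>y. f y $ i) has_derivative (\<lambda>h. 0)) (at x within S)"
    proof (rule has_derivative_transform[OF x])
      show "f y $ i = 0" if "y \<in> S" for y
        using im that \<open>i \<notin> J\<close> by (auto simp: model_space_def)
    qed simp
    ultimately show ?thesis
      by (rule has_derivative_model_unique[OF S x v])
  qed
  then show ?thesis
    by (simp add: model_space_def)
qed

lemma model_space_expansion:
  assumes "v \<in> model_space I"
  shows "v = (\<Sum>i\<in>I. v $ i *\<^sub>R axis i 1)"
proof -
  have "(\<Sum>i\<in>I. v $ i *\<^sub>R axis i 1) $ j = v $ j" for j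
  proof -
    have "(\<Sum>i\<in>I. v $ i *\<^sub>R axis i 1) $ j = (\<Sum>i\<in>I. if j = i then v $ j else 0)"
      unfolding sum_component by (rule sum.cong) (auto simp: axis_def)
    also have "\<dots> = v $ j"
      using assms by (simp add: model_space_def)
    finally show ?thesis .
  qed
  then show ?thesis
    by (simp add: vec_eq_iff)
qed

lemma axis_in_model_space [simp]: "i \<in> I \<Longrightarrow> axis i a \<in> model_space I"
  by (auto simp: model_space_def axis_def)

lemma sum_fun_apply: "(\<Sum>i\<in>I. f i) x = (\<Sum>i\<in>I. f i x)"
  for f :: "'i \<Rightarrow> 'a \<Rightarrow> 'b::comm_monoid_add"
  by (induction I rule: infinite_finite_induct) (auto simp: zero_fun_def)

text \<open>Links analysis to algebra: the right side has the form of the completed matrix in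
  \<open>has_det\<close>. Columns outside \<open>I\<close> come from the identity block; those in
  \<open>I\<close> have no entries outside \<open>I\<close> because \<open>f\<close> preserves the
  model space.\<close>

lemma block_det_eq:
  assumes f: "linear f" and "\<And>h. h \<in> model_space I \<Longrightarrow> f h \<in> model_space I"
  shows "block_det I f =
    det (\<chi> i j. if i \<in> I \<and> j \<in> I then f (axis j 1) $ i else if i = j then 1 else 0)"
proof -
  have "matrix (\<lambda>h. f (proj_model I h) + (h - proj_model I h)) $ i $ j =
      (if i \<in> I \<and> j \<in> I then f (axis j 1) $ i else if i = j then 1 else 0)"
    for i j
  proof (cases "j \<in> I")
    case True
    then have "proj_model I (axis j (1 :: real)) = axis j 1"
      by (simp add: proj_model_id)
    moreover have "f (axis j 1) $ i = 0" if "i \<notin> I"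
    proof -
      have "f (axis j 1) \<in> model_space I"
        by (rule assms) (use True in simp)
      then show ?thesis
        using that by (simp add: model_space_def)
    qed
    ultimately show ?thesis
      using True by (auto simp: matrix_def)
  next
    case False
    then have "proj_model I (axis j (1 :: real)) = 0"
      by (auto simp: proj_model_def axis_def vec_eq_iff)
    then show ?thesis
      using False linear_0[OF f] by (simp add: matrix_def axis_def)
  qed
  then show ?thesis
    unfolding block_det_def by (intro arg_cong[where f = det]) (simp add: vec_eq_iff)
qed

lemma tangent_spaceI:
  assumes "\<And>c. \<not> (c \<in> A \<and> q \<in> fst c) \<Longrightarrow> v c = 0"
    and "\<And>c. c \<in> A \<Longrightarrow> q \<in> fst c \<Longrightarrow> v c \<in> model_space I"
    and "\<And>c d. c \<in> A \<Longrightarrow> d \<in> A \<Longrightarrow> q \<in> fst c \<Longrightarrow> q \<in> fst d \<Longrightarrow> v d = jacobian c d q (v c)"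
  shows "v \<in> tangent_space I A q"
  using assms unfolding tangent_space_def by blast

lemma tangent_spaceD:
  assumes "v \<in> tangent_space I A q"
  shows "\<not> (c \<in> A \<and> q \<in> fst c) \<Longrightarrow> v c = 0"
    and "c \<in> A \<Longrightarrow> q \<in> fst c \<Longrightarrow> v c \<in> model_space I"
    and "c \<in> A \<Longrightarrow> d \<in> A \<Longrightarrow> q \<in> fst c \<Longrightarrow> q \<in> fst d \<Longrightarrow> v d = jacobian c d q (v c)"
  using assms unfolding tangent_space_def by blast+

lemma locally_compact_spaceI:
  assumes "\<And>x. x \<in> topspace X \<Longrightarrow> \<exists>U K. openin X U \<and> compactin X K \<and> x \<in> U \<and> U \<subseteq> K"
  shows "locally_compact_space X"
  using assms by (auto simp: locally_compact_space_def)

section \<open>Charts, transition maps and the chain rule\<close>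

locale smooth_atlas =
  fixes M :: "'m topology" and I :: "'n::finite set" and A :: "('m, 'n) chart set"
  assumes smooth_manifold: "smooth_manifold M I A"
begin

lemma chart: "c \<in> A \<Longrightarrow> is_chart M I c"
  using smooth_manifold by (simp add: smooth_manifold_def)

lemma chart_domain_open: "c \<in> A \<Longrightarrow> openin M (fst c)"
  using chart by (simp add: is_chart_def)

lemma chart_domain_subset: "c \<in> A \<Longrightarrow> fst c \<subseteq> topspace M"
  using chart_domain_open by (rule openin_subset)

lemma topspace_subtopology_chart: "c \<in> A \<Longrightarrow> topspace (subtopology M (fst c)) = fst c"
  by (simp add: Int_absorb1 chart_domain_subset)

lemma chart_inj: "c \<in> A \<Longrightarrow> inj_on (snd c) (fst c)"
  using chart[of c] topspace_subtopology_chart[of c] homeomorphic_imp_injective_map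
  by (fastforce simp: is_chart_def)

lemma chart_image_open:
  assumes c: "c \<in> A" and U: "openin M U" "U \<subseteq> fst c"
  shows "openin (top_of_set (model_space I)) (snd c ` U)"
proof -
  have h: "homeomorphic_map (subtopology M (fst c)) (top_of_set (snd c ` fst c)) (snd c)"
    and o: "openin (top_of_set (model_space I)) (snd c ` fst c)"
    using chart[OF c] by (auto simp: is_chart_def)
  have "openin (subtopology M (fst c)) U"
    using U by (simp add: openin_open_subtopology chart_domain_open[OF c])
  then have "openin (top_of_set (snd c ` fst c)) (snd c ` U)"
    using homeomorphic_imp_open_map[OF h] by (simp add: open_map_def)
  then show ?thesis
    using o by (rule openin_trans)
qed

lemma chart_image_subset: "c \<in> A \<Longrightarrow> snd c ` fst c \<subseteq> model_space I"
  using chart_image_open[OF _ chart_domain_open order_refl] openin_subset by force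

text \<open>The inverse homeomorphism coincides on the chart image with \<open>inv_into\<close>, the
  form that occurs in \<open>transition\<close> and \<open>chart_integral\<close>.\<close>

lemma chart_inverse_continuous:
  assumes c: "c \<in> A"
  shows "continuous_map (top_of_set (snd c ` fst c)) (subtopology M (fst c)) (inv_into (fst c) (snd c))"
proof -
  have "homeomorphic_map (subtopology M (fst c)) (top_of_set (snd c ` fst c)) (snd c)"
    using chart[OF c] by (simp add: is_chart_def)
  then obtain g where g: "homeomorphic_maps (subtopology M (fst c)) (top_of_set (snd c ` fst c)) (snd c) g"
    by (auto simp: homeomorphic_map_maps)
  then have "g y = inv_into (fst c) (snd c) y" if "y \<in> snd c ` fst c" for y
    using that chart_inj[OF c] topspace_subtopology_chart[OF c]
    by (auto simp: homeomorphic_maps_def inv_into_f_f)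
  then show ?thesis
    using g by (auto simp: homeomorphic_maps_def intro: continuous_map_eq)
qed

lemma transition_has_derivative:
  assumes "c \<in> A" "d \<in> A" "q \<in> fst c" "q \<in> fst d"
  shows "(transition c d has_derivative jacobian c d q) (at (snd c q) within snd c ` (fst c \<inter> fst d))"
proof -
  have "compatible I c d"
    using smooth_manifold assms by (auto simp: smooth_manifold_def)
  then have "Ck_on (Suc 0) I (snd c ` (fst c \<inter> fst d)) (transition c d)"
    unfolding compatible_def smooth_on_def by blast
  then have "transition c d differentiable (at (snd c q) within snd c ` (fst c \<inter> fst d))"
    using assms by (auto simp: differentiable_on_def)
  then show ?thesis
    unfolding jacobian_def by (simp add: frechet_derivative_works)
qed

lemma jacobian_linear:
  "c \<in> A \<Longrightarrow> d \<in> A \<Longrightarrow> q \<in> fst c \<Longrightarrow> q \<in> fst d \<Longrightarrow> linear (jacobian c d q)"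
  using transition_has_derivative by (rule has_derivative_linear)

lemma transition_apply: "c \<in> A \<Longrightarrow> q \<in> fst c \<Longrightarrow> transition c d (snd c q) = snd d q"
  using chart_inj by (simp add: transition_def inv_into_f_f)

lemma overlap_image_open:
  "c \<in> A \<Longrightarrow> d \<in> A \<Longrightarrow> openin (top_of_set (model_space I)) (snd c ` (fst c \<inter> fst d))"
  by (intro chart_image_open openin_Int chart_domain_open) auto

lemma jacobian_in_model_space:
  assumes cd: "c \<in> A" "d \<in> A" "q \<in> fst c" "q \<in> fst d" and v: "v \<in> model_space I"
  shows "jacobian c d q v \<in> model_space I"
proof (rule has_derivative_model_range[OF overlap_image_open[OF cd(1,2)] _ v transition_has_derivative[OF cd]])
  show "transition c d ` snd c ` (fst c \<inter> fst d) \<subseteq> model_space I"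
    using chart_image_subset[OF cd(2)] transition_apply[OF cd(1), of _ d] by auto
qed (use cd in auto)

lemma jacobian_self:
  assumes c: "c \<in> A" "q \<in> fst c" and v: "v \<in> model_space I"
  shows "jacobian c c q v = v"
proof (rule has_derivative_model_unique[OF overlap_image_open[OF c(1) c(1)] _ v transition_has_derivative[OF c(1) c(1) c(2) c(2)]])
  show "(transition c c has_derivative (\<lambda>h. h)) (at (snd c q) within snd c ` (fst c \<inter> fst c))"
    by (rule has_derivative_transform[OF _ _ has_derivative_ident])
      (use c transition_apply[OF c(1), of _ c] in auto)
qed (use c in auto)

text \<open>Each \<open>jacobian\<close> is a derivative within its own overlap. Restriction to the
  triple overlap makes them comparable: it is again open in the model space, so derivatives within
  it agree on model vectors.\<close>

lemma jacobian_chain: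
  assumes A: "c \<in> A" "d \<in> A" "e \<in> A" and q: "q \<in> fst c" "q \<in> fst d" "q \<in> fst e"
    and v: "v \<in> model_space I"
  shows "jacobian d e q (jacobian c d q v) = jacobian c e q v"
proof -
  let ?U = "fst c \<inter> fst d \<inter> fst e"
  let ?S = "snd c ` ?U"
  have S: "openin (top_of_set (model_space I)) ?S"
    using A by (intro chart_image_open openin_Int chart_domain_open) auto
  have x: "snd c q \<in> ?S"
    using q by auto
  have "(transition c d has_derivative jacobian c d q) (at (snd c q) within ?S)"
    by (rule has_derivative_subset[OF transition_has_derivative]) (use A q in auto)
  moreover have "(transition d e has_derivative jacobian d e q) (at (transition c d (snd c q)) within transition c d ` ?S)"
    unfolding transition_apply[OF A(1) q(1)]
    by (rule has_derivative_subset[OF transition_has_derivative])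
      (use A q transition_apply[OF A(1), of _ d] in auto)
  ultimately have "(transition d e \<circ> transition c d has_derivative jacobian d e q \<circ> jacobian c d q)
      (at (snd c q) within ?S)"
    by (rule diff_chain_within)
  moreover have "(transition d e \<circ> transition c d has_derivative jacobian c e q) (at (snd c q) within ?S)"
  proof (rule has_derivative_transform[OF x])
    show "(transition c e has_derivative jacobian c e q) (at (snd c q) within ?S)"
      by (rule has_derivative_subset[OF transition_has_derivative]) (use A q in auto)
    show "(transition d e \<circ> transition c d) y = transition c e y" if "y \<in> ?S" for y
      using that transition_apply[OF A(1), of _ d] transition_apply[OF A(1), of _ e]
        transition_apply[OF A(2), of _ e] by auto
  qed
  ultimately have "(jacobian d e q \<circ> jacobian c d q) v = jacobian c e q v"
    by (rule has_derivative_model_unique[OF S x v])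
  then show ?thesis
    by simp
qed

section \<open>Tangent spaces and coordinate frames\<close>

lemma coord_frame_in_tangent_space:
  assumes "c \<in> A" "q \<in> fst c" "i \<in> I"
  shows "coord_frame I A c q i \<in> tangent_space I A q"
  using assms by (auto simp: coord_frame_def tangent_space_def zero_fun_def
      intro: jacobian_in_model_space jacobian_chain[symmetric])

lemma coord_frame_in: "c \<in> A \<Longrightarrow> q \<in> fst c \<Longrightarrow> coord_frame I A c q \<in> I \<rightarrow>\<^sub>E tangent_space I A q"
  using coord_frame_in_tangent_space by (auto simp: PiE_iff coord_frame_def)

text \<open>The coordinates in \<open>d\<close> determine those in every other chart through a
  linear Jacobian, so expanding the single vector \<open>v d\<close> in axes expands the whole
  family.\<close>

lemma tangent_expansion:
  assumes v: "v \<in> tangent_space I A q" and d: "d \<in> A" "q \<in> fst d"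
  shows "v = (\<Sum>i\<in>I. v d $ i *\<^sub>R coord_frame I A d q i)"
proof
  fix e
  have sum: "(\<Sum>i\<in>I. v d $ i *\<^sub>R coord_frame I A d q i) e =
      (\<Sum>i\<in>I. v d $ i *\<^sub>R coord_frame I A d q i e)"
    by (simp add: sum_fun_apply scaleR_fun_def)
  show "v e = (\<Sum>i\<in>I. v d $ i *\<^sub>R coord_frame I A d q i) e"
  proof (cases "e \<in> A \<and> q \<in> fst e")
    case True
    have "v d \<in> model_space I"
      by (rule tangent_spaceD(2)[OF v d])
    then have "jacobian d e q (v d) = jacobian d e q (\<Sum>i\<in>I. v d $ i *\<^sub>R axis i 1)"
      by (intro arg_cong[where f = "jacobian d e q"] model_space_expansion)
    also have "\<dots> = (\<Sum>i\<in>I. v d $ i *\<^sub>R jacobian d e q (axis i 1))"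
      using jacobian_linear[of d e q] d True by (simp add: linear_sum linear_scale)
    finally show ?thesis
      using True d tangent_spaceD(3)[OF v, of d e] unfolding sum by (simp add: coord_frame_def)
  next
    case False
    then show ?thesis
      using False tangent_spaceD(1)[OF v, of e] unfolding sum by (auto simp: coord_frame_def intro!: sum.neutral)
  qed
qed

lemma coord_frame_self: "c \<in> A \<Longrightarrow> q \<in> fst c \<Longrightarrow> i \<in> I \<Longrightarrow> coord_frame I A c q i c = axis i 1"
  by (simp add: coord_frame_def jacobian_self)

lemma subspace_tangent_space: "subspace (tangent_space I A q)"
proof (rule subspaceI)
  show "0 \<in> tangent_space I A q"
    by (rule tangent_spaceI) (simp_all add: linear_0[OF jacobian_linear] model_space_def)
next
  fix x y assume x: "x \<in> tangent_space I A q" and y: "y \<in> tangent_space I A q"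
  show "x + y \<in> tangent_space I A q"
  proof (rule tangent_spaceI)
    show "(x + y) c = 0" if "\<not> (c \<in> A \<and> q \<in> fst c)" for c
      using tangent_spaceD(1)[OF x that] tangent_spaceD(1)[OF y that] by simp
    show "(x + y) c \<in> model_space I" if "c \<in> A" "q \<in> fst c" for c
      using tangent_spaceD(2)[OF x that] tangent_spaceD(2)[OF y that]
      by (simp add: subspace_add[OF subspace_model_space])
    show "(x + y) d = jacobian c d q ((x + y) c)" if "c \<in> A" "d \<in> A" "q \<in> fst c" "q \<in> fst d" for c d
      unfolding plus_fun_apply linear_add[OF jacobian_linear[OF that]]
      by (intro arg_cong2[where f = plus] tangent_spaceD(3)[OF x that] tangent_spaceD(3)[OF y that])
  qed
next
  fix r x assume x: "x \<in> tangent_space I A q"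
  show "r *\<^sub>R x \<in> tangent_space I A q"
  proof (rule tangent_spaceI)
    show "(r *\<^sub>R x) c = 0" if "\<not> (c \<in> A \<and> q \<in> fst c)" for c
      using tangent_spaceD(1)[OF x that] by (simp add: scaleR_fun_def)
    show "(r *\<^sub>R x) c \<in> model_space I" if "c \<in> A" "q \<in> fst c" for c
      using tangent_spaceD(2)[OF x that]
      by (simp add: scaleR_fun_def subspace_scale[OF subspace_model_space])
    show "(r *\<^sub>R x) d = jacobian c d q ((r *\<^sub>R x) c)" if "c \<in> A" "d \<in> A" "q \<in> fst c" "q \<in> fst d" for c d
      unfolding scaleR_fun_def linear_scale[OF jacobian_linear[OF that]]
      by (intro arg_cong[where f = "scaleR r"] tangent_spaceD(3)[OF x that])
  qed
qed

text \<open>Evaluation at \<open>d\<close> turns the frame into the standard axes, whence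
  injectivity and independence; spanning is \<open>tangent_expansion\<close>.\<close>

lemma basis_of_coord_frame:
  assumes d: "d \<in> A" "q \<in> fst d"
  shows "basis_of I (tangent_space I A q) (coord_frame I A d q)"
proof -
  let ?b = "coord_frame I A d q"
  have inj: "inj_on ?b I"
  proof (rule inj_onI)
    fix i j assume "i \<in> I" "j \<in> I" "?b i = ?b j"
    then have "axis i (1 :: real) = axis j 1"
      using coord_frame_self[OF d] by metis
    then show "i = j"
      by (simp add: axis_eq_axis)
  qed
  have "independent (?b ` I)"
  proof (rule independent_if_scalars_zero)
    fix f v assume *: "(\<Sum>x\<in>?b ` I. f x *\<^sub>R x) = 0" and "v \<in> ?b ` I"
    then obtain i where i: "i \<in> I" "v = ?b i"
      by blast
    have "0 = (\<Sum>j\<in>I. f (?b j) *\<^sub>R ?b j) d"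
      using * by (simp add: sum.reindex[OF inj])
    also have "\<dots> = (\<Sum>j\<in>I. f (?b j) *\<^sub>R axis j (1 :: real))"
      unfolding sum_fun_apply by (rule sum.cong) (simp_all add: scaleR_fun_def coord_frame_self d)
    finally have "(\<Sum>j\<in>I. f (?b j) *\<^sub>R axis j (1 :: real)) = 0"
      by (rule sym)
    then have zero: "(\<Sum>j\<in>I. f (?b j) *\<^sub>R axis j (1 :: real)) $ i = 0"
      by (simp only: zero_index)
    have "(\<Sum>j\<in>I. f (?b j) *\<^sub>R axis j (1 :: real)) $ i = (\<Sum>j\<in>I. if i = j then f (?b i) else 0)"
      unfolding sum_component by (rule sum.cong) (auto simp: axis_def)
    then show "f v = 0"
      using i zero by simp
  qed simp
  moreover have "span (?b ` I) = tangent_space I A q"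
  proof
    show "span (?b ` I) \<subseteq> tangent_space I A q"
      by (rule span_minimal[OF _ subspace_tangent_space])
        (use coord_frame_in_tangent_space[OF d] in auto)
    show "tangent_space I A q \<subseteq> span (?b ` I)"
    proof
      fix v assume "v \<in> tangent_space I A q"
      then have "v = (\<Sum>i\<in>I. v d $ i *\<^sub>R ?b i)"
        using d by (rule tangent_expansion)
      also have "\<dots> \<in> span (?b ` I)"
        by (intro span_sum span_scale span_base) auto
      finally show "v \<in> span (?b ` I)" .
    qed
  qed
  ultimately show ?thesis
    using inj by (simp add: basis_of_def)
qed

text \<open>The law in \<open>densities\<close> concerns endomorphisms of one tangent space, so the
  change of charts is realised as the endomorphism sending the frame of \<open>d\<close> to that of
  \<open>c\<close>. Its matrix in the frame of \<open>d\<close> is given by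
  \<open>jacobian c d q\<close>.\<close>

lemma density_coord_frame_change:
  assumes \<delta>: "\<delta> \<in> densities I (tangent_space I A q)"
    and cd: "c \<in> A" "d \<in> A" "q \<in> fst c" "q \<in> fst d"
  shows "\<delta> (coord_frame I A c q) = \<bar>block_det I (jacobian c d q)\<bar> * \<delta> (coord_frame I A d q)"
proof -
  let ?b = "coord_frame I A d q" and ?V = "tangent_space I A q" and ?J = "jacobian c d q"
  have basis: "inj_on ?b I" "independent (?b ` I)" "span (?b ` I) = ?V"
    using basis_of_coord_frame[OF cd(2,4)] by (auto simp: basis_of_def)
  \<comment> \<open>The assignment on the independent frame is extended to the ambient type, since
    \<open>densities\<close> quantifies over linear maps defined there.\<close>
  obtain T where T: "linear T" "\<And>x. x \<in> ?b ` I \<Longrightarrow> T x = coord_frame I A c q (inv_into I ?b x)"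
    using linear_independent_extend[OF basis(2), of "\<lambda>x. coord_frame I A c q (inv_into I ?b x)"] by blast
  have Tb: "T (?b j) = coord_frame I A c q j" if "j \<in> I" for j
    using that basis(1) by (simp add: T(2) inv_into_f_f)
  have "T ` ?V = span (T ` ?b ` I)"
    unfolding basis(3)[symmetric] by (rule linear_span_image[OF T(1), symmetric])
  also have "\<dots> \<subseteq> ?V"
    by (rule span_minimal[OF _ subspace_tangent_space])
      (use Tb coord_frame_in_tangent_space[OF cd(1,3)] in auto)
  finally have TV: "T ` ?V \<subseteq> ?V" .
  have "T (?b j) = (\<Sum>i\<in>I. ?J (axis j 1) $ i *\<^sub>R ?b i)" if j: "j \<in> I" for j
  proof -
    have "coord_frame I A c q j d = ?J (axis j 1)"
      using j cd by (simp add: coord_frame_def)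
    then show ?thesis
      using tangent_expansion[OF coord_frame_in_tangent_space[OF cd(1,3) j] cd(2,4)]
      by (simp add: Tb j)
  qed
  then have "has_det I ?V T (block_det I ?J)"
    unfolding has_det_def
    using basis_of_coord_frame[OF cd(2,4)] block_det_eq[OF jacobian_linear[OF cd] jacobian_in_model_space[OF cd]]
    by (intro exI[of _ ?b] exI[of _ "\<lambda>i j. ?J (axis j 1) $ i"]) simp
  then have "\<delta> (\<lambda>i\<in>I. T (?b i)) = \<bar>block_det I ?J\<bar> * \<delta> ?b"
    using \<delta> T(1) TV coord_frame_in[OF cd(2,4)] unfolding densities_def mem_Collect_eq by blast
  moreover have "(\<lambda>i\<in>I. T (?b i)) = coord_frame I A c q"
    using Tb by (auto simp: coord_frame_def fun_eq_iff)
  ultimately show ?thesis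
    by simp
qed

text \<open>The Leibniz formula makes the determinant a polynomial in the partial derivatives, which
  are continuous by \<open>Ck_on (Suc 0)\<close>.\<close>

lemma continuous_on_block_det_jacobian:
  assumes cd: "c \<in> A" "d \<in> A"
  shows "continuous_on (snd c ` (fst c \<inter> fst d))
    (\<lambda>x. block_det I (jacobian c d (inv_into (fst c) (snd c) x)))"
proof -
  let ?S = "snd c ` (fst c \<inter> fst d)"
  let ?J = "\<lambda>x. jacobian c d (inv_into (fst c) (snd c) x)"
  have "compatible I c d"
    using smooth_manifold cd by (auto simp: smooth_manifold_def)
  then have "Ck_on (Suc 0) I ?S (transition c d)"
    unfolding compatible_def smooth_on_def by blast
  then have *: "continuous_on ?S (\<lambda>x. frechet_derivative (transition c d) (at x within ?S) (axis i 1))" if "i \<in> I" for i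
    using that by simp
  have inv: "inv_into (fst c) (snd c) x \<in> fst c \<inter> fst d" "snd c (inv_into (fst c) (snd c) x) = x" if "x \<in> ?S" for x
    using that chart_inj[OF cd(1)] by (auto simp: inv_into_f_f)
  have J: "continuous_on ?S (\<lambda>x. ?J x (axis i 1))" if "i \<in> I" for i
    using *[OF that] by (rule continuous_on_eq) (simp add: jacobian_def inv)
  have "continuous_on ?S (\<lambda>x. det (\<chi> i j. if i \<in> I \<and> j \<in> I then ?J x (axis j 1) $ i else if i = j then 1 else 0))"
    unfolding det_def
  proof (intro continuous_on_sum continuous_on_mult continuous_on_const continuous_on_prod)
    fix p :: "'n \<Rightarrow> 'n" and i :: 'n
    show "continuous_on ?S (\<lambda>x. (\<chi> i j. if i \<in> I \<and> j \<in> I then ?J x (axis j 1) $ i else if i = j then 1 else 0) $ i $ p i)"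
      by (cases "i \<in> I \<and> p i \<in> I") (auto intro!: continuous_intros J)
  qed
  then show ?thesis
  proof (rule continuous_on_eq)
    fix x assume "x \<in> ?S"
    note q = inv(1)[OF this]
    show "det (\<chi> i j. if i \<in> I \<and> j \<in> I then ?J x (axis j 1) $ i else if i = j then 1 else 0) = block_det I (?J x)"
      by (rule block_det_eq[symmetric]) (use q cd in \<open>auto intro: jacobian_linear jacobian_in_model_space\<close>)
  qed
qed

section \<open>Local compactness and countable atlases\<close>

lemma chart_at:
  assumes "q \<in> topspace M"
  obtains c where "c \<in> A" "q \<in> fst c"
proof -
  have "(\<Union>c\<in>A. fst c) = topspace M"
    using smooth_manifold by (simp add: smooth_manifold_def)
  then show ?thesis
    using assms that by blast
qed

text \<open>The chart inverse carries a small closed ball of coordinates, intersected with the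
  closed model space, to a compact neighbourhood.\<close>

lemma locally_compact_space: "locally_compact_space M"
proof (rule locally_compact_spaceI)
  fix q assume "q \<in> topspace M"
  then obtain c where c: "c \<in> A" "q \<in> fst c"
    by (rule chart_at)
  let ?S = "snd c ` fst c" and ?inv = "inv_into (fst c) (snd c)" and ?y = "snd c q"
  obtain T where T: "open T" "?S = model_space I \<inter> T"
    using chart_image_open[OF c(1) chart_domain_open[OF c(1)] order_refl] unfolding openin_open by blast
  have "?y \<in> T"
    using c(2) T(2) by blast
  then obtain r where r: "0 < r" "cball ?y r \<subseteq> T"
    using T(1) open_contains_cball by metis
  let ?C = "cball ?y r \<inter> model_space I"
  have "compactin (top_of_set ?S) ?C"
    using r(2) T(2) by (auto simp: compactin_subtopology intro: compact_Int_closed closed_model_space)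
  then have K: "compactin M (?inv ` ?C)"
    using image_compactin[OF _ chart_inverse_continuous[OF c(1)]] by (auto simp: compactin_subtopology)
  have "homeomorphic_map (subtopology M (fst c)) (top_of_set ?S) (snd c)"
    using chart[OF c(1)] by (simp add: is_chart_def)
  then have "continuous_map (subtopology M (fst c)) euclidean (snd c)"
    using homeomorphic_imp_continuous_map continuous_map_into_fulltopology by blast
  then have "openin (subtopology M (fst c)) {x \<in> topspace (subtopology M (fst c)). snd c x \<in> ball ?y r}"
    by (rule openin_continuous_map_preimage) simp
  then have U: "openin M {x \<in> fst c. snd c x \<in> ball ?y r}"
    unfolding topspace_subtopology_chart[OF c(1)] openin_open_subtopology[OF chart_domain_open[OF c(1)]] by simp
  have "{x \<in> fst c. snd c x \<in> ball ?y r} \<subseteq> ?inv ` ?C"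
  proof
    fix x assume x: "x \<in> {x \<in> fst c. snd c x \<in> ball ?y r}"
    then have "snd c x \<in> ?C"
      using T(2) by auto
    moreover have "?inv (snd c x) = x"
      using x chart_inj[OF c(1)] by (simp add: inv_into_f_f)
    ultimately show "x \<in> ?inv ` ?C"
      by (metis imageI)
  qed
  then show "\<exists>U K. openin M U \<and> compactin M K \<and> q \<in> U \<and> U \<subseteq> K"
    using U K c(2) r(1) by (intro exI[of _ "{x \<in> fst c. snd c x \<in> ball ?y r}"] exI[of _ "?inv ` ?C"]) simp
qed

sublocale locally_compact_second_countable M
  using smooth_manifold locally_compact_space by unfold_locales (simp_all add: smooth_manifold_def)

lemma countable_atlas:
  obtains C where "countable C" "C \<subseteq> A" "(\<Union>c\<in>C. fst c) = topspace M"
proof -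
  have "(\<Union>c\<in>A. fst c) = topspace M"
    using smooth_manifold by (simp add: smooth_manifold_def)
  then have "\<exists>\<V>. countable \<V> \<and> \<V> \<subseteq> fst ` A \<and> \<Union>\<V> = topspace M"
    by (intro Lindelof_spaceD[OF second_countable_imp_Lindelof_space[OF second_countable]])
      (use chart_domain_open in auto)
  then obtain \<V> where V: "countable \<V>" "\<V> \<subseteq> fst ` A" "\<Union>\<V> = topspace M"
    by (elim exE conjE)
  have "\<exists>C. countable C \<and> C \<subseteq> A \<and> \<V> = fst ` C"
    by (rule iffD1[OF countable_subset_image conjI[OF V(1,2)]])
  then obtain C where "countable C" "C \<subseteq> A" "\<V> = fst ` C"
    by (elim exE conjE)
  with V(3) show ?thesis
    by (intro that[of C]) auto
qed

subsection \<open>The measure of a density\<close>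

text \<open>Carries the Borel \<sigma>-algebra of \<open>M\<close> in a form suited to measurability
  arguments; as a measure it is zero.\<close>

definition borel_of_M :: "'m measure" where
  "borel_of_M = sigma (topspace M) {U. openin M U}"

lemma space_borel_of_M [simp]: "space borel_of_M = topspace M"
  by (simp add: borel_of_M_def space_measure_of_conv)

lemma openin_Pow: "{U. openin M U} \<subseteq> Pow (topspace M)"
  using openin_subset by auto

lemma sets_borel_of_M: "sets borel_of_M = sigma_sets (topspace M) {U. openin M U}"
  unfolding borel_of_M_def by (rule sets_measure_of[OF openin_Pow])

lemma borel_measure_iff: "borel_measure M N \<longleftrightarrow> sets N = sets borel_of_M"
  using sets_eq_imp_space_eq[of N borel_of_M] by (auto simp: borel_measure_def sets_borel_of_M)

lemma borel_measure_borel_of_M: "borel_measure M borel_of_M"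
  by (simp add: borel_measure_iff)

lemma chart_domain_sets: "c \<in> A \<Longrightarrow> fst c \<in> sets borel_of_M"
  using borel_measure_openin[OF borel_measure_borel_of_M chart_domain_open] .

lemma chart_image_borel:
  assumes "c \<in> A" "openin M U" "U \<subseteq> fst c"
  shows "snd c ` U \<in> sets borel"
proof -
  obtain T where "open T" "snd c ` U = model_space I \<inter> T"
    using chart_image_open[OF assms] unfolding openin_open by blast
  then show ?thesis
    using closed_model_space by (metis borel_closed borel_open sets.Int)
qed

lemma chart_inverse_measurable:
  assumes c: "c \<in> A"
  shows "inv_into (fst c) (snd c) \<in> restrict_space (model_measure I) (snd c ` fst c) \<rightarrow>\<^sub>M borel_of_M"
  unfolding borel_of_M_def
proof (rule measurable_measure_of[OF openin_Pow])
  let ?S = "snd c ` fst c" and ?inv = "inv_into (fst c) (snd c)"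
  have S: "?S \<in> sets borel"
    by (rule chart_image_borel[OF c chart_domain_open[OF c] order_refl])
  have inv: "?inv y \<in> fst c" if "y \<in> ?S" for y
    using that by (rule inv_into_into)
  show "?inv \<in> space (restrict_space (model_measure I) ?S) \<rightarrow> topspace M"
    using inv chart_domain_subset[OF c] by (auto simp: space_restrict_space)
  fix U assume "U \<in> {U. openin M U}"
  then have "openin (subtopology M (fst c)) (U \<inter> fst c)"
    by (auto simp: openin_subtopology)
  then have "openin (top_of_set ?S) {y \<in> topspace (top_of_set ?S). ?inv y \<in> U \<inter> fst c}"
    by (rule openin_continuous_map_preimage[OF chart_inverse_continuous[OF c]])
  moreover have "{y \<in> topspace (top_of_set ?S). ?inv y \<in> U \<inter> fst c} = ?inv -` U \<inter> ?S"
    using inv by auto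
  ultimately obtain T where "open T" "?inv -` U \<inter> ?S = ?S \<inter> T"
    unfolding openin_open by auto
  then show "?inv -` U \<inter> space (restrict_space (model_measure I) ?S) \<in> sets (restrict_space (model_measure I) ?S)"
    using S by (auto simp: space_restrict_space sets_restrict_space)
qed

end

text \<open>Tonelli for counting measure on the naturals.\<close>

lemma suminf_ennreal_swap: "(\<Sum>i. \<Sum>n. f i n) = (\<Sum>n. \<Sum>i. f i n)" for f :: "nat \<Rightarrow> nat \<Rightarrow> ennreal"
  using nn_integral_suminf[of f "count_space UNIV"] by (simp add: nn_integral_count_space_nat)

locale smooth_density = smooth_atlas M I A
  for M :: "'m topology" and I :: "'n::finite set" and A :: "('m, 'n) chart set" +
  fixes \<mu> :: "'m \<Rightarrow> ('n \<Rightarrow> ('m, 'n) tangent) \<Rightarrow> real"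
  assumes density: "nonneg_density M I A \<mu>"
begin

section \<open>Coefficients of the density in charts\<close>

definition coeff :: "('m, 'n) chart \<Rightarrow> 'm \<Rightarrow> real" where
  "coeff c q = \<mu> q (coord_frame I A c q)"

text \<open>Continuity into the bundle forces the values into the fibres: the generating sets of its
  topology contain only points of \<open>density_total\<close>.\<close>

lemma density_in:
  assumes "q \<in> topspace M"
  shows "(q, \<mu> q) \<in> density_total M I A"
proof -
  have "continuous_map M (density_bundle M I A) (\<lambda>q. (q, \<mu> q))"
    using density by (simp add: nonneg_density_def is_density_def)
  then have "(q, \<mu> q) \<in> topspace (density_bundle M I A)"
    using assms continuous_map_image_subset_topspace by blast
  then show ?thesis
    by (auto simp: density_bundle_def topology_generated_by_topspace)
qed

lemma coeff_change:
  assumes "c \<in> A" "d \<in> A" "q \<in> fst c" "q \<in> fst d"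
  shows "coeff c q = \<bar>block_det I (jacobian c d q)\<bar> * coeff d q"
proof -
  have "\<mu> q \<in> densities I (tangent_space I A q)"
    using density_in[of q] chart_domain_subset[OF assms(1)] assms(3) by (auto simp: density_total_def)
  then show ?thesis
    unfolding coeff_def using assms by (rule density_coord_frame_change)
qed

lemma coeff_nonneg: "c \<in> A \<Longrightarrow> q \<in> fst c \<Longrightarrow> 0 \<le> coeff c q"
  using density coord_frame_in[of c q] chart_domain_subset[of c] by (auto simp: nonneg_density_def coeff_def)

text \<open>The generating sets of the bundle topology over the whole domain of \<open>c\<close>
  pull back along the section to the preimages of open sets under \<open>coeff c\<close>.\<close>

lemma coeff_continuous:
  assumes c: "c \<in> A"
  shows "continuous_map (subtopology M (fst c)) euclideanreal (coeff c)"
proof -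
  have "openin (subtopology M (fst c)) {q \<in> fst c. coeff c q \<in> J}" if J: "open J" for J
  proof -
    let ?G = "{(q, \<delta>) \<in> density_total M I A. q \<in> fst c \<and> \<delta> (coord_frame I A c q) \<in> J}"
    have "openin (density_bundle M I A) ?G"
      unfolding density_bundle_def
      by (rule topology_generated_by_Basis) (use c J chart_domain_open in blast)
    moreover have "continuous_map M (density_bundle M I A) (\<lambda>q. (q, \<mu> q))"
      using density by (simp add: nonneg_density_def is_density_def)
    ultimately have "openin M {q \<in> topspace M. (q, \<mu> q) \<in> ?G}"
      by (rule openin_continuous_map_preimage[rotated])
    moreover have "{q \<in> topspace M. (q, \<mu> q) \<in> ?G} = {q \<in> fst c. coeff c q \<in> J}"
      using density_in chart_domain_subset[OF c] by (auto simp: coeff_def)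
    ultimately show ?thesis
      by (auto simp: openin_open_subtopology chart_domain_open[OF c])
  qed
  then show ?thesis
    unfolding continuous_map_def topspace_subtopology_chart[OF c] by simp
qed

lemma coeff_continuous_on:
  assumes c: "c \<in> A"
  shows "continuous_on (snd c ` fst c) (\<lambda>y. coeff c (inv_into (fst c) (snd c) y))"
  using continuous_map_compose[OF chart_inverse_continuous[OF c] coeff_continuous[OF c]]
  by (simp add: o_def)

section \<open>Chart measures and their agreement on overlaps\<close>

text \<open>Restriction to the chart image precedes the push-forward because \<open>inv_into\<close>
  is arbitrary elsewhere. The result is defined on all Borel sets of \<open>M\<close> but
  concentrated on \<open>fst c\<close>.\<close>

definition chart_measure :: "('m, 'n) chart \<Rightarrow> 'm measure" where
  "chart_measure c =
    distr (density (restrict_space (model_measure I) (snd c ` fst c)) (\<lambda>y. ennreal (coeff c (inv_into (fst c) (snd c) y))))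
      borel_of_M (inv_into (fst c) (snd c))"

lemma sets_chart_measure [simp]: "sets (chart_measure c) = sets borel_of_M"
  by (simp add: chart_measure_def)

lemma coeff_measurable:
  assumes c: "c \<in> A"
  shows "(\<lambda>y. coeff c (inv_into (fst c) (snd c) y)) \<in> borel_measurable (restrict_space (model_measure I) (snd c ` fst c))"
proof -
  have "sets (restrict_space (model_measure I) (snd c ` fst c)) = sets (restrict_space borel (snd c ` fst c))"
    by (rule sets_restrict_space_cong) simp
  then show ?thesis
    using borel_measurable_continuous_on_restrict[OF coeff_continuous_on[OF c]]
    by (simp cong: measurable_cong_sets)
qed

lemma nn_integral_chart_measure:
  assumes c: "c \<in> A" and g: "g \<in> borel_measurable borel_of_M"
  shows "(\<integral>\<^sup>+ q. g q \<partial>chart_measure c) =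
    (\<integral>\<^sup>+ y. (ennreal (coeff c (inv_into (fst c) (snd c) y)) * g (inv_into (fst c) (snd c) y)) * indicator (snd c ` fst c) y \<partial>model_measure I)"
proof -
  let ?S = "snd c ` fst c" and ?inv = "inv_into (fst c) (snd c)"
  let ?R = "restrict_space (model_measure I) ?S"
  have S: "?S \<inter> space (model_measure I) \<in> sets (model_measure I)"
    using chart_image_borel[OF c chart_domain_open[OF c] order_refl] by simp
  note [measurable] = chart_inverse_measurable[OF c] coeff_measurable[OF c] g
  have "(\<integral>\<^sup>+ q. g q \<partial>chart_measure c) = (\<integral>\<^sup>+ y. g (?inv y) \<partial>density ?R (\<lambda>y. ennreal (coeff c (?inv y))))"
    unfolding chart_measure_def by (rule nn_integral_distr) simp_all
  also have "\<dots> = (\<integral>\<^sup>+ y. ennreal (coeff c (?inv y)) * g (?inv y) \<partial>?R)"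
    by (rule nn_integral_density) simp_all
  also have "\<dots> = (\<integral>\<^sup>+ y. (ennreal (coeff c (?inv y)) * g (?inv y)) * indicator ?S y \<partial>model_measure I)"
    by (rule nn_integral_restrict_space[OF S])
  finally show ?thesis .
qed

lemma emeasure_chart_measure:
  assumes c: "c \<in> A" and E: "E \<in> sets borel_of_M"
  shows "emeasure (chart_measure c) E =
    (\<integral>\<^sup>+ y. (ennreal (coeff c (inv_into (fst c) (snd c) y)) * indicator E (inv_into (fst c) (snd c) y)) * indicator (snd c ` fst c) y \<partial>model_measure I)"
  using nn_integral_chart_measure[OF c, of "indicator E"] E by simp

text \<open>Change of variables along the transition map: the absolute determinant that it produces
  is the factor in \<open>coeff_change\<close> turning the coefficient for \<open>d\<close> into
  that for \<open>c\<close>.\<close>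

lemma chart_measure_agree:
  assumes cd: "c \<in> A" "d \<in> A" and E: "E \<in> sets borel_of_M" "E \<subseteq> fst c" "E \<subseteq> fst d"
  shows "emeasure (chart_measure c) E = emeasure (chart_measure d) E"
proof -
  let ?ic = "inv_into (fst c) (snd c)" and ?id = "inv_into (fst d) (snd d)"
  let ?Sc = "snd c ` fst c" and ?Sd = "snd d ` fst d" and ?S = "snd c ` (fst c \<inter> fst d)"
  let ?\<phi> = "transition c d"
  let ?F = "\<lambda>z. (ennreal (coeff d (?id z)) * indicator E (?id z)) * indicator ?Sd z"
  note invc = inv_into_f_f[OF chart_inj[OF cd(1)]] and invd = inv_into_f_f[OF chart_inj[OF cd(2)]]
  have ov: "openin M (fst c \<inter> fst d)"
    by (intro openin_Int chart_domain_open cd)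
  have S: "?S \<in> sets borel"
    by (rule chart_image_borel[OF cd(1) ov]) auto
  have im: "?\<phi> ` ?S = snd d ` (fst c \<inter> fst d)"
    using transition_apply[OF cd(1), of _ d] by (force simp: image_image)
  \<comment> \<open>The factor \<open>indicator ?Sd\<close> turns measurability on the image of
    \<open>d\<close> into measurability on the whole space.\<close>
  have F: "?F \<in> borel_measurable borel"
  proof -
    have SdS: "?Sd \<inter> space (model_measure I) \<in> sets (model_measure I)"
      using chart_image_borel[OF cd(2) chart_domain_open[OF cd(2)] order_refl] by simp
    note [measurable] = chart_inverse_measurable[OF cd(2)] coeff_measurable[OF cd(2)] E(1)
    have "(\<lambda>z. ennreal (coeff d (?id z)) * indicator E (?id z)) \<in>
        borel_measurable (restrict_space (model_measure I) ?Sd)"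
      by measurable
    then have "?F \<in> borel_measurable (model_measure I)"
      by (rule iffD1[OF borel_measurable_restrict_space_iff_ennreal[OF SdS]])
    then show ?thesis
      by (simp cong: measurable_cong_sets)
  qed
  have "emeasure (chart_measure d) E = (\<integral>\<^sup>+ z. ?F z \<partial>model_measure I)"
    by (rule emeasure_chart_measure[OF cd(2) E(1)])
  \<comment> \<open>Since \<open>E\<close> lies in both domains, the integrand vanishes off the
    image of the overlap.\<close>
  also have "\<dots> = (\<integral>\<^sup>+ z. indicator (?\<phi> ` ?S) z * ?F z \<partial>model_measure I)"
  proof (rule nn_integral_cong)
    fix z
    show "?F z = indicator (?\<phi> ` ?S) z * ?F z"
    proof (cases "z \<in> ?Sd \<and> ?id z \<in> E")
      case True
      then have "z = snd d (?id z)"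
        by (simp add: f_inv_into_f)
      then have "z \<in> ?\<phi> ` ?S"
        unfolding im using True E by blast
      then show ?thesis
        by simp
    qed (auto simp: indicator_def)
  qed
  also have "\<dots> = (\<integral>\<^sup>+ x. indicator ?S x * (ennreal \<bar>block_det I (jacobian c d (?ic x))\<bar> * ?F (?\<phi> x)) \<partial>model_measure I)"
  proof (rule nn_integral_model_image[OF S])
    show "?S \<subseteq> model_space I"
      using chart_image_subset[OF cd(1)] by auto
    show "?\<phi> ` ?S \<subseteq> model_space I"
      unfolding im using chart_image_subset[OF cd(2)] by auto
    show "(?\<phi> has_derivative jacobian c d (?ic x)) (at x within ?S)" if "x \<in> ?S" for x
      using that transition_has_derivative[OF cd] invc by auto
    show "inj_on ?\<phi> ?S"
    proof (rule inj_onI)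
      fix x y assume "x \<in> ?S" "y \<in> ?S" and eq: "?\<phi> x = ?\<phi> y"
      then obtain p q where pq: "x = snd c p" "y = snd c q" "p \<in> fst c" "p \<in> fst d" "q \<in> fst c" "q \<in> fst d"
        by auto
      then have "snd d p = snd d q"
        using eq transition_apply[OF cd(1), of _ d] by metis
      then have "p = q"
        using chart_inj[OF cd(2)] pq by (auto dest: inj_onD)
      then show "x = y"
        using pq by simp
    qed
    show "?\<phi> ` ?S \<in> sets borel"
      unfolding im by (rule chart_image_borel[OF cd(2) ov]) auto
  qed (rule continuous_on_block_det_jacobian[OF cd], rule F)
  also have "\<dots> = (\<integral>\<^sup>+ y. (ennreal (coeff c (?ic y)) * indicator E (?ic y)) * indicator ?Sc y \<partial>model_measure I)"
  proof (rule nn_integral_cong)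
    fix x
    show "indicator ?S x * (ennreal \<bar>block_det I (jacobian c d (?ic x))\<bar> * ?F (?\<phi> x)) =
        (ennreal (coeff c (?ic x)) * indicator E (?ic x)) * indicator ?Sc x"
    proof (cases "x \<in> ?S")
      case True
      then obtain q where q: "x = snd c q" "q \<in> fst c" "q \<in> fst d"
        by auto
      have "?ic x = q" "?\<phi> x = snd d q" "?id (?\<phi> x) = q"
        using q invc invd transition_apply[OF cd(1), of q d] by auto
      then show ?thesis
        using True q coeff_change[OF cd q(2,3)] coeff_nonneg[OF cd(2) q(3)]
        by (simp add: ennreal_mult mult.assoc)
    next
      case False
      have "?ic x \<notin> E" if "x \<in> ?Sc"
      proof
        assume "?ic x \<in> E"
        moreover have "x = snd c (?ic x)"
          using that by (simp add: f_inv_into_f)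
        ultimately show False
          using False E by blast
      qed
      then show ?thesis
        using False by (cases "x \<in> ?Sc") simp_all
    qed
  qed
  also have "\<dots> = emeasure (chart_measure c) E"
    by (rule emeasure_chart_measure[OF cd(1) E(1), symmetric])
  finally show ?thesis ..
qed

lemma emeasure_chart_measure_Int:
  assumes c: "c \<in> A" and E: "E \<in> sets borel_of_M"
  shows "emeasure (chart_measure c) (E \<inter> fst c) = emeasure (chart_measure c) E"
proof -
  have "E \<inter> fst c \<in> sets borel_of_M"
    using E chart_domain_sets[OF c] by (rule sets.Int)
  then show ?thesis
    unfolding emeasure_chart_measure[OF c E] emeasure_chart_measure[OF c \<open>E \<inter> fst c \<in> sets borel_of_M\<close>]
    by (intro nn_integral_cong) (auto simp: indicator_def inv_into_into)
qed

text \<open>A countable cover by chart domains is cut into disjoint Borel pieces \<open>B n\<close>,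
  each measured in its own chart. By \<open>chart_measure_agree\<close> any other chart containing a
  part of a piece measures it alike, so the sum agrees with every chart of the atlas.\<close>

lemma glued_measure_exists:
  "\<exists>N. borel_measure M N \<and>
    (\<forall>c\<in>A. \<forall>E\<in>sets N. E \<subseteq> fst c \<longrightarrow> emeasure N E = emeasure (chart_measure c) E)"
proof -
  obtain C where C: "countable C" "C \<subseteq> A" "(\<Union>c\<in>C. fst c) = topspace M"
    by (rule countable_atlas)
  show ?thesis
  \<comment> \<open>Enumeration by \<open>from_nat_into\<close> requires a nonempty cover; otherwise
    \<open>M\<close> is empty and the zero measure serves.\<close>
  proof (cases "C = {}")
    case True
    then have "topspace M = {}"
      using C(3) by simp
    then show ?thesis
      using borel_measure_borel_of_M chart_domain_subset by (intro exI[of _ borel_of_M]) auto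
  next
    case False
    define c where "c = from_nat_into C"
    have cA: "c n \<in> A" for n
      using from_nat_into[OF False] C(2) by (auto simp: c_def)
    define B where "B = disjointed (\<lambda>n. fst (c n))"
    have "(\<Union>n. fst (c n)) = (\<Union>d\<in>C. fst d)"
      using range_from_nat_into[OF False C(1)] unfolding c_def by (metis image_image)
    then have UN_B: "(\<Union>n. B n) = topspace M"
      using C(3) by (simp add: B_def UN_disjointed_eq)
    have B_sub: "B n \<subseteq> fst (c n)" for n
      unfolding B_def by (rule disjointed_subset)
    have disj: "disjoint_family B"
      unfolding B_def by (rule disjoint_family_disjointed)
    have "range B \<subseteq> sets borel_of_M"
      unfolding B_def by (rule sets.range_disjointed_sets) (use chart_domain_sets[OF cA] in auto)
    then have B_sets: "B n \<in> sets borel_of_M" for n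
      by auto
    define e where "e E = (\<Sum>n. emeasure (chart_measure (c n)) (E \<inter> B n))" for E
    define N where "N = measure_of (topspace M) {U. openin M U} e"
    have setsN: "sets N = sets borel_of_M"
      unfolding N_def sets_borel_of_M by (rule sets_measure_of[OF openin_Pow])
    have emN: "emeasure N E = e E" if E: "E \<in> sets borel_of_M" for E
    proof (rule emeasure_measure_of[OF N_def openin_Pow])
      show "positive (sets N) e"
        by (simp add: positive_def e_def)
      show "countably_additive (sets N) e"
      proof (rule countably_additiveI)
        fix F :: "nat \<Rightarrow> 'm set"
        assume F: "range F \<subseteq> sets N" "disjoint_family F"
        have "(\<Sum>i. e (F i)) = (\<Sum>n. \<Sum>i. emeasure (chart_measure (c n)) (F i \<inter> B n))"
          unfolding e_def by (rule suminf_ennreal_swap)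
        also have "\<dots> = e (\<Union>i. F i)"
          unfolding e_def
        proof (rule suminf_cong)
          fix n
          have "(\<Sum>i. emeasure (chart_measure (c n)) (F i \<inter> B n)) =
              emeasure (chart_measure (c n)) (\<Union>i. F i \<inter> B n)"
          proof (rule suminf_emeasure)
            show "range (\<lambda>i. F i \<inter> B n) \<subseteq> sets (chart_measure (c n))"
              using F(1) B_sets setsN by auto
            show "disjoint_family (\<lambda>i. F i \<inter> B n)"
              using F(2) by (auto simp: disjoint_family_on_def)
          qed
          moreover have "(\<Union>i. F i \<inter> B n) = (\<Union>i. F i) \<inter> B n"
            by blast
          ultimately show "(\<Sum>i. emeasure (chart_measure (c n)) (F i \<inter> B n)) =
              emeasure (chart_measure (c n)) ((\<Union>i. F i) \<inter> B n)"
            by simp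
        qed
        finally show "(\<Sum>i. e (F i)) = e (\<Union>i. F i)" .
      qed
      show "E \<in> sets N"
        using E setsN by simp
    qed
    show ?thesis
    proof (intro exI[of _ N] conjI ballI impI)
      show "borel_measure M N"
        by (simp add: borel_measure_iff setsN)
      fix d E assume d: "d \<in> A" and "E \<in> sets N" and Ed: "E \<subseteq> fst d"
      then have E: "E \<in> sets borel_of_M"
        by (simp add: setsN)
      have "emeasure N E = (\<Sum>n. emeasure (chart_measure (c n)) (E \<inter> B n))"
        by (simp add: emN[OF E] e_def)
      also have "\<dots> = (\<Sum>n. emeasure (chart_measure d) (E \<inter> B n))"
      proof (rule suminf_cong)
        fix n
        show "emeasure (chart_measure (c n)) (E \<inter> B n) = emeasure (chart_measure d) (E \<inter> B n)"
          by (rule chart_measure_agree[OF cA d sets.Int[OF E B_sets]]) (use B_sub Ed in blast)+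
      qed
      also have "\<dots> = emeasure (chart_measure d) (\<Union>n. E \<inter> B n)"
      proof (rule suminf_emeasure)
        show "range (\<lambda>n. E \<inter> B n) \<subseteq> sets (chart_measure d)"
          using E B_sets by auto
        show "disjoint_family (\<lambda>n. E \<inter> B n)"
          using disj by (auto simp: disjoint_family_on_def)
      qed
      also have "(\<Union>n. E \<inter> B n) = E"
        using UN_B sets.sets_into_space[OF E] by auto
      finally show "emeasure N E = emeasure (chart_measure d) E" .
    qed
  qed
qed

text \<open>The coefficient is bounded on the compact coordinate image of \<open>K\<close>, and this
  image has finite model measure because the unit cylinder over it is bounded.\<close>

lemma chart_measure_compact_finite:
  assumes c: "c \<in> A" and K: "compactin M K" "K \<subseteq> fst c"
  shows "emeasure (chart_measure c) K < \<infinity>"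
proof -
  let ?S = "snd c ` fst c" and ?inv = "inv_into (fst c) (snd c)" and ?C = "snd c ` K"
  have "homeomorphic_map (subtopology M (fst c)) (top_of_set ?S) (snd c)"
    using chart[OF c] by (simp add: is_chart_def)
  then have "compactin (top_of_set ?S) ?C"
    using K by (intro image_compactin[OF _ homeomorphic_imp_continuous_map]) (auto simp: compactin_subtopology)
  then have C: "compact ?C"
    by (simp add: compactin_subtopology)
  have "continuous_on ?C (\<lambda>y. coeff c (?inv y))"
    using coeff_continuous_on[OF c] by (rule continuous_on_subset) (use K(2) in auto)
  then have "compact ((\<lambda>y. coeff c (?inv y)) ` ?C)"
    using C by (rule compact_continuous_image)
  then obtain b where b: "\<And>y. y \<in> ?C \<Longrightarrow> norm (coeff c (?inv y)) \<le> b"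
    by (metis (no_types, lifting) compact_imp_bounded bounded_iff imageI)
  have KB: "K \<in> sets borel_of_M"
    by (rule borel_measure_closedin[OF borel_measure_borel_of_M compactin_imp_closedin[OF Hausdorff K(1)]])
  have CB: "?C \<in> sets borel"
    using C by (rule borel_compact)
  have "emeasure (chart_measure c) K \<le> (\<integral>\<^sup>+ y. ennreal b * indicator ?C y \<partial>model_measure I)"
    unfolding emeasure_chart_measure[OF c KB]
  proof (rule nn_integral_mono)
    fix y
    show "(ennreal (coeff c (?inv y)) * indicator K (?inv y)) * indicator ?S y \<le> ennreal b * indicator ?C y"
    proof (cases "y \<in> ?S \<and> ?inv y \<in> K")
      case True
      then have "?inv y \<in> K" "snd c (?inv y) = y"
        by (simp_all add: f_inv_into_f)
      then have "y \<in> ?C"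
        by (metis imageI)
      then show ?thesis
        using True b[of y] by (auto intro!: ennreal_leI)
    qed auto
  qed
  also have "\<dots> = ennreal b * emeasure (model_measure I) ?C"
    by (rule nn_integral_cmult_indicator) (use CB in simp)
  finally have le: "emeasure (chart_measure c) K \<le> ennreal b * emeasure (model_measure I) ?C" .
  have "emeasure (model_measure I) ?C < \<infinity>"
  proof -
    obtain r where r: "\<And>y. y \<in> ?C \<Longrightarrow> norm y \<le> r"
      using compact_imp_bounded[OF C] by (auto simp: bounded_iff)
    \<comment> \<open>\<open>r\<close> bounds the coordinates in \<open>I\<close>, and 1 bounds
      those confined by the unit cube.\<close>
    have "{x \<in> unit_cube I. proj_model I x \<in> ?C} \<subseteq> cbox (vec (- max r 1)) (vec (max r 1))"
    proof
      fix x assume x: "x \<in> {x \<in> unit_cube I. proj_model I x \<in> ?C}"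
      have "\<bar>x $ i\<bar> \<le> max r 1" for i
      proof (cases "i \<in> I")
        case True
        then have "x $ i = proj_model I x $ i"
          by (simp add: proj_model_def)
        then have "\<bar>x $ i\<bar> \<le> norm (proj_model I x)"
          by (metis component_le_norm_cart)
        also have "\<dots> \<le> r"
          using r x by blast
        finally show ?thesis
          by simp
      next
        case False
        then show ?thesis
          using x by (auto simp: unit_cube_def)
      qed
      then show "x \<in> cbox (vec (- max r 1)) (vec (max r 1))"
        by (simp add: mem_box_cart abs_le_iff minus_le_iff)
    qed
    then have "emeasure lborel {x \<in> unit_cube I. proj_model I x \<in> ?C} < \<infinity>"
      by (intro emeasure_bounded_finite) (rule bounded_subset[OF bounded_cbox])
    then show ?thesis
      by (simp add: emeasure_model_measure[OF CB])
  qed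
  then have "ennreal b * emeasure (model_measure I) ?C < \<infinity>"
    by (simp add: ennreal_mult_less_top)
  with le show ?thesis
    by (rule order.strict_trans1)
qed

end

section \<open>The glued measure and the density integral\<close>

locale glued_measure = smooth_density M I A \<mu>
  for M :: "'m topology" and I :: "'n::finite set" and A :: "('m, 'n) chart set"
    and \<mu> :: "'m \<Rightarrow> ('n \<Rightarrow> ('m, 'n) tangent) \<Rightarrow> real" +
  fixes N :: "'m measure"
  assumes borel: "borel_measure M N"
    and emeasure_chart: "\<And>c E. c \<in> A \<Longrightarrow> E \<in> sets N \<Longrightarrow> E \<subseteq> fst c \<Longrightarrow> emeasure N E = emeasure (chart_measure c) E"
begin

lemma sets_N [simp]: "sets N = sets borel_of_M"
  using borel by (simp add: borel_measure_iff)

lemma space_N [simp]: "space N = topspace M"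
  using borel by (simp add: borel_measure_def)

text \<open>\<open>K\<close> need not lie in one chart domain, but finitely many open sets cover it,
  each contained in a compact subset of some chart domain.\<close>

lemma compact_finite:
  assumes K: "compactin M K"
  shows "emeasure N K < \<infinity>"
proof -
  have "\<exists>W. openin M W \<and> q \<in> W \<and> emeasure N W < \<infinity>" if "q \<in> K" for q
  proof -
    have "q \<in> topspace M"
      using compactin_subset_topspace[OF K] that by blast
    then obtain c where c: "c \<in> A" "q \<in> fst c"
      by (rule chart_at)
    obtain W L where WL: "openin M W" "compactin M L" "q \<in> W" "W \<subseteq> L" "L \<subseteq> fst c"
      using compact_neighbourhood[OF chart_domain_open[OF c(1)] c(2)] by metis
    have L: "L \<in> sets N"
      by (rule borel_measure_closedin[OF borel compactin_imp_closedin[OF Hausdorff WL(2)]])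
    have "emeasure N W \<le> emeasure N L"
      by (rule emeasure_mono[OF WL(4) L])
    also have "\<dots> = emeasure (chart_measure c) L"
      by (rule emeasure_chart[OF c(1) L WL(5)])
    also have "\<dots> < \<infinity>"
      by (rule chart_measure_compact_finite[OF c(1) WL(2,5)])
    finally show ?thesis
      using WL(1,3) by blast
  qed
  then obtain W where W: "\<And>q. q \<in> K \<Longrightarrow> openin M (W q) \<and> q \<in> W q \<and> emeasure N (W q) < \<infinity>"
    by metis
  have "\<exists>\<F>. finite \<F> \<and> \<F> \<subseteq> W ` K \<and> K \<subseteq> \<Union>\<F>"
    by (rule compactinD[OF K]) (use W in auto)
  then obtain F where F: "finite F" "F \<subseteq> K" "K \<subseteq> (\<Union>q\<in>F. W q)"
    by (metis finite_subset_image)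
  have WN: "W q \<in> sets N" if "q \<in> F" for q
    using borel_measure_openin[OF borel] W F(2) that by blast
  have "emeasure N K \<le> emeasure N (\<Union>q\<in>F. W q)"
    by (rule emeasure_mono[OF F(3)]) (use WN F(1) in auto)
  also have "\<dots> \<le> (\<Sum>q\<in>F. emeasure N (W q))"
    by (rule emeasure_subadditive_finite[OF F(1)]) (use WN in auto)
  also have "\<dots> < \<infinity>"
    using F W by (auto simp: less_top)
  finally show ?thesis .
qed

text \<open>Agreement on sets becomes an equality of measures, which transfers Bochner integrals of
  signed functions directly.\<close>

lemma density_indicator_chart:
  assumes c: "c \<in> A"
  shows "density N (indicator (fst c)) = chart_measure c"
proof (rule measure_eqI)
  fix E assume "E \<in> sets (density N (indicator (fst c)))"
  then have E: "E \<in> sets borel_of_M"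
    by simp
  note Ec = sets.Int[OF E chart_domain_sets[OF c]]
  have "emeasure (density N (indicator (fst c))) E = (\<integral>\<^sup>+ q. indicator (fst c) q * indicator E q \<partial>N)"
    by (rule emeasure_density) (use E chart_domain_sets[OF c] in \<open>auto intro: borel_measurable_indicator\<close>)
  also have "\<dots> = (\<integral>\<^sup>+ q. indicator (E \<inter> fst c) q \<partial>N)"
    by (intro nn_integral_cong) (simp add: indicator_inter_arith mult.commute)
  also have "\<dots> = emeasure N (E \<inter> fst c)"
    by (rule nn_integral_indicator) (use Ec in simp)
  also have "\<dots> = emeasure (chart_measure c) (E \<inter> fst c)"
    by (rule emeasure_chart[OF c]) (use Ec in auto)
  also have "\<dots> = emeasure (chart_measure c) E"
    by (rule emeasure_chart_measure_Int[OF c E])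
  finally show "emeasure (density N (indicator (fst c))) E = emeasure (chart_measure c) E" .
qed simp

text \<open>Each rewriting is an identity of Bochner integrals of measurable functions, with value 0
  on both sides in the nonintegrable case. Vanishing off the domain of \<open>c\<close> removes the
  restriction to it at the end.\<close>

lemma chart_integral_eq:
  assumes c: "c \<in> A" and f: "f \<in> borel_measurable borel_of_M"
    and supp: "\<And>q. q \<in> topspace M \<Longrightarrow> q \<notin> fst c \<Longrightarrow> f q = 0"
  shows "chart_integral I A c (density_scale f \<mu>) = (\<integral>q. f q \<partial>N)"
proof -
  let ?S = "snd c ` fst c" and ?inv = "inv_into (fst c) (snd c)"
  let ?R = "restrict_space (model_measure I) ?S"
  let ?g = "\<lambda>y. indicator ?S y *\<^sub>R (coeff c (?inv y) * f (?inv y))"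
  have S: "?S \<inter> space (model_measure I) \<in> sets (model_measure I)"
    using chart_image_borel[OF c chart_domain_open[OF c] order_refl] by simp
  note [measurable] = chart_inverse_measurable[OF c] coeff_measurable[OF c] f
  have "(\<lambda>y. coeff c (?inv y) * f (?inv y)) \<in> borel_measurable ?R"
    by measurable
  then have "?g \<in> borel_measurable (model_measure I)"
    by (rule iffD1[OF borel_measurable_restrict_space_iff[OF S]])
  then have g: "?g \<in> borel_measurable borel"
    by (simp cong: measurable_cong_sets)
  have "chart_integral I A c (density_scale f \<mu>) =
      (\<integral>x. ?g (\<chi> i. if i \<in> I then x i else 0) \<partial>(\<Pi>\<^sub>M i\<in>I. lborel))"
    unfolding chart_integral_def Let_def density_scale_def coeff_def[symmetric]
    by (intro Bochner_Integration.integral_cong) (auto simp: indicator_def)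
  also have "\<dots> = (\<integral>y. ?g y \<partial>model_measure I)"
    unfolding model_measure_def by (rule integral_distr[OF measurable_model_embedding g, symmetric])
  also have "\<dots> = (\<integral>y. coeff c (?inv y) * f (?inv y) \<partial>?R)"
    by (rule integral_restrict_space[OF S, symmetric])
  also have "\<dots> = (\<integral>y. f (?inv y) \<partial>density ?R (\<lambda>y. ennreal (coeff c (?inv y))))"
  proof (subst integral_density)
    show "AE y in ?R. 0 \<le> coeff c (?inv y)"
      by (intro AE_I2) (auto simp: space_restrict_space intro!: coeff_nonneg[OF c] inv_into_into)
  qed simp_all
  also have "\<dots> = (\<integral>q. f q \<partial>chart_measure c)"
    unfolding chart_measure_def by (rule integral_distr[symmetric]) simp_all
  also have "\<dots> = (\<integral>q. f q \<partial>density N (\<lambda>q. ennreal (indicator (fst c) q)))"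
    by (simp add: density_indicator_chart[OF c] ennreal_indicator)
  also have "\<dots> = (\<integral>q. indicator (fst c) q *\<^sub>R f q \<partial>N)"
    by (rule integral_density) (use chart_domain_sets[OF c] in \<open>simp_all cong: measurable_cong_sets\<close>)
  also have "\<dots> = (\<integral>q. f q \<partial>N)"
    by (rule Bochner_Integration.integral_cong) (use supp in \<open>auto simp: indicator_def\<close>)
  finally show ?thesis .
qed

text \<open>Serves to discard the points where \<open>f\<close> is nonzero but the functions of a
  partition do not sum to 1.\<close>

lemma null_set_if_coeff_zero:
  assumes Z: "Z \<in> sets N" and zero: "\<And>c q. c \<in> A \<Longrightarrow> q \<in> Z \<Longrightarrow> q \<in> fst c \<Longrightarrow> coeff c q = 0"
  shows "Z \<in> null_sets N"
proof -
  obtain C where C: "countable C" "C \<subseteq> A" "(\<Union>c\<in>C. fst c) = topspace M"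
    by (rule countable_atlas)
  have ZB: "Z \<in> sets borel_of_M"
    using Z by simp
  have "Z \<inter> fst c \<in> null_sets N" if "c \<in> C" for c
  proof -
    have c: "c \<in> A"
      using C(2) that by blast
    note sets = sets.Int[OF ZB chart_domain_sets[OF c]]
    have "emeasure N (Z \<inter> fst c) = emeasure (chart_measure c) (Z \<inter> fst c)"
      by (rule emeasure_chart[OF c]) (use sets in auto)
    also have "\<dots> = (\<integral>\<^sup>+ y. 0 \<partial>model_measure I)"
      unfolding emeasure_chart_measure[OF c sets]
      by (rule nn_integral_cong) (auto simp: indicator_def zero[OF c])
    finally show ?thesis
      using sets by (simp add: null_sets_def)
  qed
  then have "(\<Union>c\<in>C. Z \<inter> fst c) \<in> null_sets N"
    by (rule null_sets_UN'[OF C(1)])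
  moreover have "(\<Union>c\<in>C. Z \<inter> fst c) = Z"
    using C(3) sets.sets_into_space[OF Z] by auto
  ultimately show ?thesis
    by simp
qed

lemma Cc_mult:
  assumes f: "f \<in> Cc M" and g: "continuous_map M euclideanreal g"
  shows "(\<lambda>q. g q * f q) \<in> Cc M"
proof -
  have "compactin M (supp M (\<lambda>q. g q * f q))"
  proof (rule closed_compactin)
    show "compactin M (supp M f)"
      using f by (simp add: Cc_def)
    show "supp M (\<lambda>q. g q * f q) \<subseteq> supp M f"
      unfolding supp_def by (rule closure_of_mono) auto
  qed (simp add: supp_def)
  moreover have "continuous_map M euclideanreal (\<lambda>q. g q * f q)"
    using f g by (intro continuous_map_real_mult) (auto simp: Cc_def)
  ultimately show ?thesis
    by (simp add: Cc_def)
qed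

text \<open>This is the independence of charts and partition: every term is an integral against the
  same \<open>N\<close>, and the products \<open>\<psi> j q * f q\<close> add up to
  \<open>f q\<close> almost everywhere.\<close>

lemma has_density_integral_unique:
  assumes f: "f \<in> Cc M" and s: "has_density_integral M I A (density_scale f \<mu>) s"
  shows "s = (\<integral>q. f q \<partial>N)"
proof -
  obtain k :: nat and c \<psi> where \<psi>:
      "\<And>j. j < k \<Longrightarrow> c j \<in> A"
      "\<And>j. j < k \<Longrightarrow> continuous_map M euclideanreal (\<psi> j)"
      "\<And>j. j < k \<Longrightarrow> supp M (\<psi> j) \<subseteq> fst (c j)"
    and one: "\<And>q. q \<in> density_supp M (density_scale f \<mu>) \<Longrightarrow> (\<Sum>j<k. \<psi> j q) = 1"
    and sum: "s = (\<Sum>j<k. chart_integral I A (c j) (density_scale (\<psi> j) (density_scale f \<mu>)))"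
    using s unfolding has_density_integral_def by blast
  have fc: "continuous_map M euclideanreal f"
    using f by (simp add: Cc_def)
  have Cc: "(\<lambda>q. \<psi> j q * f q) \<in> Cc M" if "j < k" for j
    by (rule Cc_mult[OF f \<psi>(2)[OF that]])
  have "chart_integral I A (c j) (density_scale (\<psi> j) (density_scale f \<mu>)) = (\<integral>q. \<psi> j q * f q \<partial>N)"
    if j: "j < k" for j
  proof -
    have "density_scale (\<psi> j) (density_scale f \<mu>) = density_scale (\<lambda>q. \<psi> j q * f q) \<mu>"
      by (simp add: density_scale_def fun_eq_iff)
    moreover have "chart_integral I A (c j) (density_scale (\<lambda>q. \<psi> j q * f q) \<mu>) = (\<integral>q. \<psi> j q * f q \<partial>N)"
    proof (rule chart_integral_eq[OF \<psi>(1)[OF j]])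
      show "(\<lambda>q. \<psi> j q * f q) \<in> borel_measurable borel_of_M"
        by (rule borel_measurable_continuous_map[OF borel_measure_borel_of_M])
          (use Cc[OF j] in \<open>simp add: Cc_def\<close>)
      show "\<psi> j q * f q = 0" if "q \<in> topspace M" "q \<notin> fst (c j)" for q
        using Cc_outside_supp[OF that(1), of "\<psi> j"] that(2) \<psi>(3)[OF j] by auto
    qed
    ultimately show ?thesis
      by simp
  qed
  then have "s = (\<Sum>j<k. \<integral>q. \<psi> j q * f q \<partial>N)"
    by (simp add: sum)
  also have "\<dots> = (\<integral>q. (\<Sum>j<k. \<psi> j q * f q) \<partial>N)"
    by (rule Bochner_Integration.integral_sum[symmetric])
      (use integrable_Cc[OF borel compact_finite Cc] in auto)
  also have "\<dots> = (\<integral>q. f q \<partial>N)"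
  proof (rule integral_cong_AE)
    have cont: "continuous_map M euclideanreal (\<lambda>q. \<Sum>j<k. \<psi> j q * f q)"
      by (rule continuous_map_sum) (use Cc in \<open>auto simp: Cc_def\<close>)
    show meas: "(\<lambda>q. \<Sum>j<k. \<psi> j q * f q) \<in> borel_measurable N" "f \<in> borel_measurable N"
      using cont fc borel_measurable_continuous_map[OF borel] by blast+
    \<comment> \<open>The \<open>\<psi> j\<close> need not sum to 1 where \<open>f \<noteq> 0\<close> but the density vanishes; that set is null.\<close>
    define Z where "Z = {q \<in> space N. (\<Sum>j<k. \<psi> j q * f q) \<noteq> f q}"
    have Z: "Z \<in> sets N"
      unfolding Z_def using meas by measurable
    have "Z \<in> null_sets N"
    proof (rule null_set_if_coeff_zero[OF Z])
      fix d q assume d: "d \<in> A" "q \<in> fst d" and q: "q \<in> Z"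
      have "f q * \<mu> q v = 0" for v
      proof (rule ccontr)
        assume "f q * \<mu> q v \<noteq> 0"
        then have "q \<in> {q \<in> topspace M. \<exists>v. density_scale f \<mu> q v \<noteq> 0}"
          using q by (auto simp: Z_def density_scale_def)
        then have "q \<in> density_supp M (density_scale f \<mu>)"
          unfolding density_supp_def by (rule subsetD[OF closure_of_subset, rotated]) auto
        then have "(\<Sum>j<k. \<psi> j q * f q) = f q"
          using one by (simp flip: sum_distrib_right)
        then show False
          using q by (simp add: Z_def)
      qed
      moreover have "f q \<noteq> 0"
        using q by (auto simp: Z_def)
      ultimately show "coeff d q = 0"
        by (simp add: coeff_def)
    qed
    then show "AE q in N. (\<Sum>j<k. \<psi> j q * f q) = f q"
      by (rule AE_I') (auto simp: Z_def)
  qed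
  finally show ?thesis .
qed

text \<open>Finitely many cutoffs are divided by their sum. The quotients have to add up to 1 only
  on \<open>K\<close>, so the divisor may be altered elsewhere to avoid zeros.\<close>

lemma partition_of_unity:
  assumes K: "compactin M K"
  shows "\<exists>(k::nat) c \<psi>.
    (\<forall>j<k. c j \<in> A \<and> continuous_map M euclideanreal (\<psi> j) \<and>
       (\<forall>q\<in>topspace M. 0 \<le> \<psi> j q \<and> \<psi> j q \<le> 1) \<and> supp M (\<psi> j) \<subseteq> fst (c j)) \<and>
    (\<forall>q\<in>K. (\<Sum>j<k. \<psi> j q) = (1 :: real))"
proof -
  have "\<exists>c \<phi>. c \<in> A \<and> \<phi> \<in> Cc M \<and> (\<forall>x\<in>topspace M. 0 \<le> \<phi> x \<and> \<phi> x \<le> 1) \<and> \<phi> q = 1 \<and> supp M \<phi> \<subseteq> fst c"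
    if q: "q \<in> K" for q
  proof -
    have qM: "q \<in> topspace M"
      using compactin_subset_topspace[OF K] q by blast
    obtain c where c: "c \<in> A" "q \<in> fst c"
      using chart_at[OF qM] by metis
    have "compactin M {q}"
      using qM by (simp add: compactin_sing)
    then obtain \<phi> where "\<phi> \<in> Cc M" "\<And>x. x \<in> topspace M \<Longrightarrow> 0 \<le> \<phi> x \<and> \<phi> x \<le> 1"
        "\<And>x. x \<in> {q} \<Longrightarrow> \<phi> x = 1" "supp M \<phi> \<subseteq> fst c"
      using cutoff_function[of "{q}" "fst c"] chart_domain_open[OF c(1)] c(2) by blast
    then show ?thesis
      using c(1) by blast
  qed
  then obtain c \<phi> where c\<phi>: "\<And>q. q \<in> K \<Longrightarrow> c q \<in> A \<and> \<phi> q \<in> Cc M \<and>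
      (\<forall>x\<in>topspace M. 0 \<le> \<phi> q x \<and> \<phi> q x \<le> (1 :: real)) \<and> \<phi> q q = 1 \<and> supp M (\<phi> q) \<subseteq> fst (c q)"
    by metis
  \<comment> \<open>Any threshold strictly between 0 and the value 1 at \<open>q\<close> would do;
    the same one has to appear in \<open>S\<close>.\<close>
  define W where "W q = {x \<in> topspace M. \<phi> q x \<in> {1/2<..}}" for q
  have W: "openin M (W q)" if "q \<in> K" for q
    unfolding W_def
    by (rule openin_continuous_map_preimage) (use c\<phi>[OF that] in \<open>auto simp: Cc_def\<close>)
  have "\<exists>\<F>. finite \<F> \<and> \<F> \<subseteq> W ` K \<and> K \<subseteq> \<Union>\<F>"
  proof (rule compactinD[OF K])
    show "K \<subseteq> \<Union> (W ` K)"
      using c\<phi> compactin_subset_topspace[OF K] by (auto simp: W_def intro!: bexI)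
  qed (use W in auto)
  then obtain F where F: "finite F" "F \<subseteq> K" "K \<subseteq> (\<Union>q\<in>F. W q)"
    by (metis finite_subset_image)
  obtain h where h: "bij_betw h {0..<card F} F"
    using ex_bij_betw_nat_finite[OF F(1)] by blast
  \<comment> \<open>On \<open>K\<close> the sum exceeds 1/2, so the maximum changes nothing there,
    while everywhere it keeps the divisor continuous and positive.\<close>
  define S where "S x = max (\<Sum>q\<in>F. \<phi> q x) (1/2)" for x
  define \<psi> where "\<psi> j x = \<phi> (h j) x / S x" for j x
  have hF: "h j \<in> F" if "j < card F" for j
    using bij_betwE[OF h] that by auto
  have S_pos: "0 < S x" for x
    by (simp add: S_def less_max_iff_disj)
  have S_cont: "continuous_map M euclideanreal S"
    unfolding S_def
    by (intro continuous_map_real_max continuous_map_sum continuous_map_const[THEN iffD2])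
      (use c\<phi> F in \<open>auto simp: Cc_def\<close>)
  show ?thesis
  proof (intro exI[of _ "card F"] exI[of _ "\<lambda>j. c (h j)"] exI[of _ \<psi>] conjI allI impI ballI)
    fix j assume j: "j < card F"
    then have hj: "h j \<in> K"
      using hF F(2) by blast
    show "c (h j) \<in> A"
      using c\<phi>[OF hj] by blast
    show "continuous_map M euclideanreal (\<psi> j)"
      unfolding \<psi>_def
      by (intro continuous_map_real_divide S_cont)
        (use c\<phi>[OF hj] S_pos in \<open>auto simp: Cc_def less_imp_neq[symmetric]\<close>)
    have "supp M (\<psi> j) \<subseteq> supp M (\<phi> (h j))"
      unfolding supp_def by (rule closure_of_mono) (auto simp: \<psi>_def)
    then show "supp M (\<psi> j) \<subseteq> fst (c (h j))"
      using c\<phi>[OF hj] by blast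
    fix x assume x: "x \<in> topspace M"
    show "0 \<le> \<psi> j x"
      using c\<phi>[OF hj] x S_pos[of x] by (simp add: \<psi>_def)
    have "\<phi> (h j) x \<le> (\<Sum>q\<in>F. \<phi> q x)"
      by (rule member_le_sum[OF hF[OF j]]) (use c\<phi> F x in auto)
    then show "\<psi> j x \<le> 1"
      using S_pos[of x] by (simp add: \<psi>_def S_def)
  next
    fix x assume x: "x \<in> K"
    then obtain q where q: "q \<in> F" "x \<in> W q"
      using F(3) by blast
    have "x \<in> topspace M"
      using compactin_subset_topspace[OF K] x by blast
    then have "0 \<le> \<phi> p x" if "p \<in> F" for p
      using c\<phi>[of p] F(2) that by blast
    then have "\<phi> q x \<le> (\<Sum>q\<in>F. \<phi> q x)"
      by (intro member_le_sum[OF q(1)] F(1)) blast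
    then have S: "S x = (\<Sum>q\<in>F. \<phi> q x)"
      using q(2) by (simp add: S_def W_def)
    have "(\<Sum>j<card F. \<psi> j x) = (\<Sum>j\<in>{0..<card F}. \<phi> (h j) x) / S x"
      by (simp add: \<psi>_def sum_divide_distrib atLeast0LessThan)
    also have "(\<Sum>j\<in>{0..<card F}. \<phi> (h j) x) = S x"
      unfolding S by (rule sum.reindex_bij_betw[OF h])
    finally show "(\<Sum>j<card F. \<psi> j x) = 1"
      using S_pos[of x] by simp
  qed
qed

text \<open>A partition of unity on the compact set \<open>supp M f\<close> is one on the support of
  \<open>f \<mu>\<close>, which it contains, so some value exists; its uniqueness gives
  \<open>THE\<close> a meaning.\<close>

lemma density_integral_eq:
  assumes f: "f \<in> Cc M"
  shows "density_integral M I A (density_scale f \<mu>) = (\<integral>q. f q \<partial>N)"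
proof -
  have "compactin M (supp M f)"
    using f by (simp add: Cc_def)
  then obtain k :: nat and c and \<psi> :: "nat \<Rightarrow> 'm \<Rightarrow> real" where \<psi>:
      "\<forall>j<k. c j \<in> A \<and> continuous_map M euclideanreal (\<psi> j) \<and>
        (\<forall>q\<in>topspace M. 0 \<le> \<psi> j q \<and> \<psi> j q \<le> 1) \<and> supp M (\<psi> j) \<subseteq> fst (c j)"
      "\<forall>q\<in>supp M f. (\<Sum>j<k. \<psi> j q) = 1"
    using partition_of_unity by metis
  have "density_supp M (density_scale f \<mu>) \<subseteq> supp M f"
    unfolding supp_def density_supp_def by (rule closure_of_mono) (auto simp: density_scale_def)
  then have "has_density_integral M I A (density_scale f \<mu>)
      (\<Sum>j<k. chart_integral I A (c j) (density_scale (\<psi> j) (density_scale f \<mu>)))"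
    unfolding has_density_integral_def using \<psi>
    by (intro exI[of _ k] exI[of _ c] exI[of _ \<psi>]) blast
  then show ?thesis
    unfolding density_integral_def using has_density_integral_unique[OF f]
    by (metis (mono_tags, lifting) the_equality)
qed

end

theorem mainTheorem9:
  fixes M :: "'m topology"
    and I :: "'n::finite set"
    and A :: "('m, 'n) chart set"
    and \<mu> :: "'m \<Rightarrow> ('n \<Rightarrow> ('m, 'n) tangent) \<Rightarrow> real"
  assumes "smooth_manifold M I A"
    and "nonneg_density M I A \<mu>"
  shows "\<exists>!N. regular_radon_measure M N \<and>
           (\<forall>f\<in>Cc M. density_integral M I A (density_scale f \<mu>) = (\<integral>q. f q \<partial>N))"
proof -
  interpret smooth_density M I A \<mu>
    using assms by unfold_locales
  obtain N where N: "borel_measure M N"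
      "\<And>c E. c \<in> A \<Longrightarrow> E \<in> sets N \<Longrightarrow> E \<subseteq> fst c \<Longrightarrow> emeasure N E = emeasure (chart_measure c) E"
    using glued_measure_exists by blast
  interpret glued_measure M I A \<mu> N
    using N by unfold_locales
  show ?thesis
  proof (rule ex1I[of _ N])
    show "regular_radon_measure M N \<and>
        (\<forall>f\<in>Cc M. density_integral M I A (density_scale f \<mu>) = (\<integral>q. f q \<partial>N))"
      using regular_radon_measureI[OF borel compact_finite] density_integral_eq by blast
    fix N' assume N': "regular_radon_measure M N' \<and>
        (\<forall>f\<in>Cc M. density_integral M I A (density_scale f \<mu>) = (\<integral>q. f q \<partial>N'))"
    \<comment> \<open>Both measures represent the density integral, so their integrals agree on
      \<open>Cc M\<close>.\<close>
    show "N' = N"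
      by (rule regular_radon_measure_unique)
        (use N' regular_radon_measureI[OF borel compact_finite] density_integral_eq in auto)
  qed
qed

end
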